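(* (i) For all $0<v_0<1$, the limiting inflow Evans function satisfies $D^0_{\rm in}(\lambda)\ne0$ for every $\lambda\ne0$ with $\operatorname{Re}\lambda\ge0$. (ii) For all $v_*<v_0<1$, the limiting outflow Evans function satisfies $D^0_{\rm out}(\lambda)\ne0$ for every $\lambda\ne0$ with $\operatorname{Re}\lambda\ge0$, where $v_*\in(0,1)$ is determined by the equation $v_*=e^{-2/(1-v_* )^2}$.
   Context: For $v_0\in(0,1)$ let $\hat v^0$ be the solution on $\mathbb{R}$ of $(\hat v^0)'=\hat v^0(\hat v^0-1)$, $\hat v^0(0)=v_0$, and $$A^0(x,\lambda)=\begin{pmatrix}0&\lambda&\lambda\\0&0&\lambda\\ \hat v^0&\hat v^0&2\hat v^0-1-\lambda\end{pmatrix}.$$ For vectors in $\mathbb{C}^3$, $x\cdot y=\sum_ix_i\bar y_i$. $\widetilde W_1^{0+}(x,\lambda)$ is the solution of $\widetilde W'=-(A^0)^*\widetilde W$ tending as $x\to+\infty$ to $(0,-1,\bar\lambda/\bar\mu)^T$, where $\mu:=-1-\lambda$, and $D^0_{\rm in}(\lambda):=(1,0,0)^T\cdot\widetilde W_1^{0+}(0,\lambda)$. For $\operatorname{Re}\lambda\ge0$, $A^0(-\infty,\lambda)$ has exactly one eigenvalue $\mu^{0-}(\lambda)$ of positive real part, with analytically chosen nonzero eigenvector $V_1^{0-}(\lambda)$; $W_1^{0-}$ is the solution of $W'=A^0W$ with $W_1^{0-}\sim e^{\mu^{0-}x}V_1^{0-}$ as $x\to-\infty$, and $D^0_{\rm out}(\lambda):=W_1^{0-}(0,\lambda)\cdot\big(0,-1,-\bar\lambda/(\bar\lambda-(\hat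 v^0)'(0))\big)^T$. *)

theory Defs
  imports "HOL-Analysis.Analysis"
begin

text \<open>
  The profile, the limiting matrix, the mode \<open>\<mu>\<close> and the distinguished solutions are introduced
  by their characterising properties via definite description, so every use of them carries
  the obligation that they exist and are unique.
\<close>

definition vhat :: "real \<Rightarrow> real \<Rightarrow> real" where
  "vhat v0 = (THE v. (\<forall>x. (v has_real_derivative v x * (v x - 1)) (at x)) \<and> v 0 = v0)"

definition A0 :: "real \<Rightarrow> real \<Rightarrow> complex \<Rightarrow> complex ^ 3 ^ 3" where
  "A0 v0 x l = (let v = complex_of_real (vhat v0 x) in
     vector [vector [0, l, l],
             vector [0, 0, l],
             vector [v, v, 2 * v - 1 - l]])"

text \<open>The library's \<open>\<bullet>\<close> on \<open>complex ^ 3\<close> is real-valued; this is the Hermitian product,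
  conjugate-linear in the second argument.\<close>

definition cdot :: "complex ^ 'n::finite \<Rightarrow> complex ^ 'n \<Rightarrow> complex" where
  "cdot x y = (\<Sum>i\<in>UNIV. x $ i * cnj (y $ i))"

definition cadjoint :: "complex ^ 'n ^ 'm \<Rightarrow> complex ^ 'm ^ 'n" where
  "cadjoint M = (\<chi> i j. cnj (M $ j $ i))"

definition solves_linear :: "(real \<Rightarrow> complex ^ 'n ^ 'n) \<Rightarrow> (real \<Rightarrow> complex ^ 'n::finite) \<Rightarrow> bool" where
  "solves_linear M W \<longleftrightarrow> (\<forall>x. (W has_vector_derivative (M x *v W x)) (at x))"

subsection \<open>Inflow\<close>

definition W1_in :: "real \<Rightarrow> complex \<Rightarrow> real \<Rightarrow> complex ^ 3" where
  "W1_in v0 l = (THE W. solves_linear (\<lambda>x. - cadjoint (A0 v0 x l)) W \<and>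
     (let \<mu> = - 1 - l in (W \<longlongrightarrow> vector [0, - 1, cnj l / cnj \<mu>]) at_top))"

definition D0_in :: "real \<Rightarrow> complex \<Rightarrow> complex" where
  "D0_in v0 l = cdot (vector [1, 0, 0]) (W1_in v0 l 0)"

subsection \<open>Outflow\<close>

definition A0_minf :: "real \<Rightarrow> complex \<Rightarrow> complex ^ 3 ^ 3" where
  "A0_minf v0 l = Lim at_bot (\<lambda>x. A0 v0 x l)"

definition mu_minus :: "real \<Rightarrow> complex \<Rightarrow> complex" where
  "mu_minus v0 l = (THE \<mu>. 0 < Re \<mu> \<and> (\<exists>w. w \<noteq> 0 \<and> A0_minf v0 l *v w = \<mu> *s w))"

text \<open>An admissible choice \<open>V\<close> of the eigenvector. The choice is not unique; the outflow Evans
  function scales by a non-vanishing analytic factor with it.\<close>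

definition analytic_eigenvector :: "real \<Rightarrow> (complex \<Rightarrow> complex ^ 3) \<Rightarrow> bool" where
  "analytic_eigenvector v0 V \<longleftrightarrow>
     (\<forall>i. (\<lambda>l. V l $ i) analytic_on {l. 0 \<le> Re l}) \<and>
     (\<forall>l. 0 \<le> Re l \<longrightarrow> V l \<noteq> 0 \<and> A0_minf v0 l *v V l = mu_minus v0 l *s V l)"

text \<open>\<open>W \<sim> e\<^sup>\<mu>\<^sup>x V\<close> as \<open>x \<rightarrow> -\<infinity>\<close> is read as \<open>e\<^sup>-\<^sup>\<mu>\<^sup>x W(x) \<rightarrow> V\<close>.\<close>

definition W1_out :: "real \<Rightarrow> (complex \<Rightarrow> complex ^ 3) \<Rightarrow> complex \<Rightarrow> real \<Rightarrow> complex ^ 3" where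
  "W1_out v0 V l = (THE W. solves_linear (\<lambda>x. A0 v0 x l) W \<and>
     ((\<lambda>x. exp (- mu_minus v0 l * complex_of_real x) *s W x) \<longlongrightarrow> V l) at_bot)"

definition D0_out :: "real \<Rightarrow> (complex \<Rightarrow> complex ^ 3) \<Rightarrow> complex \<Rightarrow> complex" where
  "D0_out v0 V l = cdot (W1_out v0 V l 0)
     (vector [0, - 1, - (cnj l / (cnj l - complex_of_real (deriv (vhat v0) 0)))])"

definition v_star :: real where
  "v_star = (THE v. 0 < v \<and> v < 1 \<and> v = exp (- 2 / (1 - v)\<^sup>2))"

end

theory Submission
  imports Defs
begin

text \<open>
  Write \<open>v\<close> for the profile, \<open>k = 1 / (1 - v)\<close> and \<open>f = v / (1 - v)\<close>. For a solution
  \<open>W = (u, w, w'/\<lambda>)\<close> of \<open>W' = A\<^sup>0 W\<close> with \<open>\<lambda> \<noteq> 0\<close>, the system reads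
  \<open>\<lambda> w + w' = u'\<close> and \<open>\<lambda> f u - (k u')' - w' = 0\<close>. The divergence form depends on \<open>k' = -f\<close>, which
  is the profile equation \<open>v' = v (v - 1)\<close>. Multiplying the second equation by the conjugate of \<open>u\<close>
  and taking real parts gives
  \<open>(Re (k u' conj u + w conj u) - |w|\<^sup>2 / 2)' = Re \<lambda> (f |u|\<^sup>2 + |w|\<^sup>2) + k |u'|\<^sup>2 \<ge> 0\<close>.
  The energy in parentheses tends to \<open>0\<close> at the end where the distinguished solution is
  prescribed, so only its value at \<open>x = 0\<close> is left to analyse.

  For outflow a zero of the Evans function is the condition \<open>u'(0) = v'(0) w(0)\<close>, under which the
  energy at \<open>0\<close> equals \<open>(1 - v0) Re (w conj u) - |w|\<^sup>2 / 2\<close>, at most \<open>(1 - v0)\<^sup>2 |u|\<^sup>2 / 2\<close>. This competes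
  with the lower bound \<open>|u(0)|\<^sup>2 / (-ln v0)\<close> that Cauchy-Schwarz extracts from the dissipation, because the
  integral of \<open>1 - v\<close> over the left half line is \<open>-ln v0\<close>. The two are incompatible unless
  \<open>u(0) = 0\<close> exactly when \<open>-ln v0 < 2 / (1 - v0)\<^sup>2\<close>, that is, when \<open>v0 > v_star\<close>
  (\<open>outflow_energy\<close>, \<open>D0_out_nonzero\<close>). For inflow the same argument is applied to the formally
  adjoint system; there a zero of the Evans function makes the energy at \<open>0\<close> nonpositive for every
  \<open>v0\<close> (\<open>inflow_energy\<close>). In both cases the solution vanishes at \<open>0\<close>, hence on the whole
  half line, which contradicts its nonzero limit.

  The distinguished solutions are given by definite descriptions, so their existence and uniqueness
  have to be established. Both systems become \<open>X' = (P - t Q) X\<close> with \<open>t\<close> a logistic function of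
  \<open>x\<close>, and \<open>X\<close> is prescribed in the limit \<open>t \<rightarrow> 0\<close>. Existence is a power series in \<open>t\<close>
  converging for \<open>|t| < 1\<close> (\<open>logistic_ode_exists\<close>). Uniqueness follows by showing that a
  solution with limit \<open>0\<close> decays faster than every exponential (\<open>triangular_system_unique\<close>).
\<close>

section \<open>Calculus for vector-valued functions of one real variable\<close>

lemma has_vector_derivative_vecI:
  fixes X :: "real \<Rightarrow> complex ^ 'n::finite"
  assumes "\<And>i. ((\<lambda>x. X x $ i) has_vector_derivative D $ i) (at x)"
  shows "(X has_vector_derivative D) (at x)"
  unfolding has_vector_derivative_def
proof (subst has_derivative_componentwise_within, rule ballI)
  fix b :: "complex ^ 'n" assume "b \<in> Basis"
  then obtain i u where b: "b = axis i u" by (auto simp: Basis_vec_def)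
  have "((\<lambda>x. X x $ i \<bullet> u) has_derivative (\<lambda>h. (h *\<^sub>R D $ i) \<bullet> u)) (at x)"
    using assms[of i] unfolding has_vector_derivative_def by (rule has_derivative_inner_left)
  then show "((\<lambda>x. X x \<bullet> b) has_derivative (\<lambda>h. h *\<^sub>R D \<bullet> b)) (at x)"
    by (simp add: b inner_axis)
qed

lemma has_vector_derivative_vec_nth:
  fixes X :: "real \<Rightarrow> complex ^ 'n::finite"
  assumes "(X has_vector_derivative D) (at x)"
  shows "((\<lambda>x. X x $ i) has_vector_derivative D $ i) (at x)"
  using bounded_linear.has_vector_derivative[OF bounded_linear_vec_nth assms] .

lemma has_vector_derivative_reflect:
  assumes "(X has_vector_derivative D) (at (- x))"
  shows "((\<lambda>x. X (- x)) has_vector_derivative - D) (at x)"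
  using vector_diff_chain_at[of uminus "- 1" x X D] assms
    has_vector_derivative_minus[OF has_vector_derivative_id, of "at x"] by (auto simp: o_def)

lemma has_vector_derivative_exp_of_real:
  "((\<lambda>x. exp (\<kappa> * complex_of_real x)) has_vector_derivative \<kappa> * exp (\<kappa> * complex_of_real x)) (at x)"
  by (rule has_vector_derivative_real_field) (auto intro!: derivative_eq_intros)

lemma has_vector_derivative_exp_smult:
  fixes X :: "real \<Rightarrow> complex ^ 'n::finite"
  assumes "(X has_vector_derivative D) (at x)"
  shows "((\<lambda>x. exp (\<kappa> * complex_of_real x) *s X x) has_vector_derivative
     exp (\<kappa> * complex_of_real x) *s (D + \<kappa> *s X x)) (at x)"
proof (rule has_vector_derivative_vecI)
  fix i
  show "((\<lambda>x. (exp (\<kappa> * complex_of_real x) *s X x) $ i) has_vector_derivative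
     (exp (\<kappa> * complex_of_real x) *s (D + \<kappa> *s X x)) $ i) (at x)"
    using has_vector_derivative_mult[OF has_vector_derivative_exp_of_real[of \<kappa> x] has_vector_derivative_vec_nth[OF assms, of i]]
    by (simp add: algebra_simps)
qed

lemma matrix_vector_mult_3:
  fixes A :: "complex ^ 3 ^ 3"
  shows "(A *v w) $ i = A $ i $ 1 * w $ 1 + A $ i $ 2 * w $ 2 + A $ i $ 3 * w $ 3"
  by (simp add: matrix_vector_mult_def sum_3)

lemma vec3_eq_iff: "(x :: 'a ^ 3) = y \<longleftrightarrow> x $ 1 = y $ 1 \<and> x $ 2 = y $ 2 \<and> x $ 3 = y $ 3"
  by (simp add: vec_eq_iff forall_3)

lemma scalar_matrix_mult: "mat \<mu> *v w = \<mu> *s w" for w :: "complex ^ 'n::finite"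
  by (simp add: vec_eq_iff matrix_vector_mult_def mat_def
      if_distrib[of "\<lambda>c. c * _"] cong: if_cong)

lemma shifted_matrix_mult: "(P - mat \<mu>) *v w = P *v w - \<mu> *s w" for w :: "complex ^ 'n::finite"
  by (simp add: matrix_vector_mult_diff_rdistrib scalar_matrix_mult)

lemma bounded_linear_matrix_vector:
  fixes P :: "complex ^ 'n::finite ^ 'n"
  shows "bounded_linear (\<lambda>w. P *v w)"
proof -
  have "linear (\<lambda>w. P *v w)"
    by (rule linearI)
      (simp_all add: vec_eq_iff matrix_vector_mult_def scaleR_sum_right
        distrib_left sum.distrib)
  then show ?thesis
    by (simp add: linear_conv_bounded_linear)
qed

section \<open>Power series solutions in the logistic variable\<close>

lemma resolvent_equation_solvable:
  fixes P :: "complex ^ 'n::finite ^ 'n"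
  assumes "\<And>w. P *v w = z *s w \<Longrightarrow> w = 0"
  shows "\<exists>y. z *s y - P *v y = w"
proof -
  have A: "(mat z - P) *v y = z *s y - P *v y" for y
    by (simp add: matrix_vector_mult_diff_rdistrib scalar_matrix_mult)
  have "inj ((*v) (mat z - P))"
  proof (rule injI)
    fix x y assume "(mat z - P) *v x = (mat z - P) *v y"
    then have "(mat z - P) *v (x - y) = 0"
      by (simp add: matrix_vector_mult_diff_distrib)
    then have "x - y = 0" using A[of "x - y"] assms[of "x - y"] by simp
    then show "x = y" by simp
  qed
  then have "surj ((*v) (mat z - P))"
    using matrix_left_invertible_injective matrix_right_invertible_surjective
      matrix_left_right_inverse by metis
  then show ?thesis using A by (metis surjD)
qed

text \<open>
  The recursion forces \<open>(n + 1 - \<parallel>P\<parallel>) \<parallel>Y (n+1)\<parallel> \<le> (n + \<parallel>Q\<parallel>) \<parallel>Y n\<parallel>\<close>, so the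
  ratio of successive norms has limit superior at most \<open>1\<close>. The unit interval is exactly the range of the logistic variable, so a single series
  represents the solution on the whole real line.
\<close>

lemma recursion_power_series_summable:
  fixes P Q :: "complex ^ 'n::finite ^ 'n"
  assumes Y: "\<And>n. of_nat (Suc n) *s Y (Suc n) - P *v Y (Suc n) = of_nat n *s Y n - Q *v Y n"
    and t: "\<bar>t\<bar> < (1::real)"
  shows "summable (\<lambda>n. t ^ n *\<^sub>R Y n)"
proof -
  obtain K where K: "K > 0" "\<And>w. norm (P *v w) \<le> norm w * K"
    using bounded_linear.pos_bounded[OF bounded_linear_matrix_vector[of P]] by blast
  obtain L where L: "L > 0" "\<And>w. norm (Q *v w) \<le> norm w * L"
    using bounded_linear.pos_bounded[OF bounded_linear_matrix_vector[of Q]] by blast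
  have ofn: "of_nat k *s w = real k *\<^sub>R w" for k and w :: "complex ^ 'n"
    by (simp add: vec_eq_iff scaleR_conv_of_real[where 'a = complex])
  have step: "(real (Suc n) - K) * norm (Y (Suc n)) \<le> (real n + L) * norm (Y n)" for n
  proof -
    have e: "real (Suc n) *\<^sub>R Y (Suc n) = P *v Y (Suc n) + (real n *\<^sub>R Y n - Q *v Y n)"
      using Y[of n] by (simp only: ofn) (simp add: algebra_simps)
    have "real (Suc n) * norm (Y (Suc n)) = norm (real (Suc n) *\<^sub>R Y (Suc n))" by simp
    also have "\<dots> \<le> norm (P *v Y (Suc n)) + (norm (real n *\<^sub>R Y n) + norm (Q *v Y n))"
      unfolding e by (intro norm_triangle_mono order_refl norm_triangle_ineq4)
    also have "\<dots> \<le> norm (Y (Suc n)) * K + (real n * norm (Y n) + norm (Y n) * L)"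
      using K(2) L(2) by (intro add_mono) auto
    finally show ?thesis by (simp add: algebra_simps)
  qed
  define r where "r = (1 + \<bar>t\<bar>) / 2"
  have r: "\<bar>t\<bar> < r" "r < 1" "0 < r" using t by (auto simp: r_def)
  obtain N :: nat where N: "real N > (\<bar>t\<bar> * L + r * K) / (r - \<bar>t\<bar>)" "real N > K"
    using reals_Archimedean2[of "max ((\<bar>t\<bar> * L + r * K) / (r - \<bar>t\<bar>)) K"] by auto
  show ?thesis
  proof (rule summable_ratio_test[OF r(2), of N])
    fix n assume n: "n \<ge> N"
    have pos: "real (Suc n) - K > 0" using N n by linarith
    have "\<bar>t\<bar> * L + r * K < real N * (r - \<bar>t\<bar>)"
      using N(1) r by (simp add: divide_less_eq)
    also have "\<dots> \<le> real n * (r - \<bar>t\<bar>)" using n r by (intro mult_right_mono) auto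
    finally have q: "\<bar>t\<bar> * (real n + L) \<le> r * (real (Suc n) - K)"
      using r by (simp add: algebra_simps)
    have "(real (Suc n) - K) * (\<bar>t\<bar> * norm (Y (Suc n))) \<le> \<bar>t\<bar> * ((real n + L) * norm (Y n))"
      using mult_left_mono[OF step[of n], of "\<bar>t\<bar>"] by (simp add: algebra_simps)
    also have "\<dots> \<le> r * (real (Suc n) - K) * norm (Y n)"
      using mult_right_mono[OF q, of "norm (Y n)"] by (simp add: algebra_simps)
    finally have "(real (Suc n) - K) * (\<bar>t\<bar> * norm (Y (Suc n))) \<le> (real (Suc n) - K) * (r * norm (Y n))"
      by (simp add: algebra_simps)
    then have "\<bar>t\<bar> * norm (Y (Suc n)) \<le> r * norm (Y n)"
      using pos by (simp only: mult_le_cancel_left_pos)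
    then have "\<bar>t\<bar> ^ n * (\<bar>t\<bar> * norm (Y (Suc n))) \<le> \<bar>t\<bar> ^ n * (r * norm (Y n))"
      by (intro mult_left_mono) auto
    then show "norm (t ^ Suc n *\<^sub>R Y (Suc n)) \<le> r * norm (t ^ n *\<^sub>R Y n)"
      by (simp add: power_abs abs_mult algebra_simps)
  qed
qed

definition logistic :: "real \<Rightarrow> real \<Rightarrow> real" where
  "logistic c x = 1 / (1 + c * exp (- x))"

lemma logistic_bounds: "c > 0 \<Longrightarrow> 0 < logistic c x" "c > 0 \<Longrightarrow> logistic c x < 1"
  by (auto simp: logistic_def field_simps add_pos_pos)

lemma logistic_deriv:
  assumes "c > 0"
  shows "(logistic c has_real_derivative logistic c x * (1 - logistic c x)) (at x)"
proof -
  have "1 + c * exp (- x) > 0" using assms by (simp add: add_pos_pos)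
  then show ?thesis unfolding logistic_def[abs_def]
    by (auto intro!: derivative_eq_intros simp: divide_simps power2_eq_square) 
qed

lemma logistic_le_exp: "c > 0 \<Longrightarrow> logistic c x \<le> (1 / c) * exp x"
  by (simp add: logistic_def exp_minus divide_simps add_pos_pos)

lemma logistic_tendsto_0:
  assumes "c > 0"
  shows "(logistic c \<longlongrightarrow> 0) at_bot"
proof (rule tendsto_sandwich)
  show "((\<lambda>_. 0) \<longlongrightarrow> 0) at_bot" by simp
  show "((\<lambda>x. (1 / c) * exp x) \<longlongrightarrow> 0) at_bot"
    using tendsto_mult_right_zero[OF exp_at_bot, of "1/c"] by simp
  show "\<forall>\<^sub>F x in at_bot. 0 \<le> logistic c x"
    using assms by (intro always_eventually allI less_imp_le logistic_bounds)
  show "\<forall>\<^sub>F x in at_bot. logistic c x \<le> (1 / c) * exp x"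
    using assms by (intro always_eventually allI logistic_le_exp)
qed

lemma logistic_at_0: "0 < v0 \<Longrightarrow> logistic ((1 - v0) / v0) 0 = v0"
  by (simp add: logistic_def field_simps)

lemma logistic_reflect:
  assumes "c > 0"
  shows "1 - logistic c (- x) = logistic (1 / c) x"
proof -
  have "1 - 1 / (1 + q) = 1 / (1 + 1 / q)" if "q > 0" for q :: real
    using that by (simp add: divide_simps)
  from this[of "c * exp x"] show ?thesis using assms
    by (simp add: logistic_def exp_minus inverse_eq_divide)
qed

text \<open>
  Common normal form of the two systems. The profile is a logistic function of \<open>x\<close> or of
  \<open>-x\<close>, so after a reflection (inflow) or removal of an exponential factor (outflow) each
  distinguished solution is characterised by its limit \<open>V\<close> at \<open>-\<infinity>\<close>, where the coefficient matrix
  tends to \<open>P\<close>.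
\<close>

definition logistic_solution ::
  "complex ^ 'n::finite ^ 'n \<Rightarrow> complex ^ 'n ^ 'n \<Rightarrow> real \<Rightarrow> complex ^ 'n \<Rightarrow> (real \<Rightarrow> complex ^ 'n) \<Rightarrow> bool" where
  "logistic_solution P Q c V X \<longleftrightarrow>
     (\<forall>x. (X has_vector_derivative (P *v X x - logistic c x *\<^sub>R (Q *v X x))) (at x)) \<and> (X \<longlongrightarrow> V) at_bot"

text \<open>
  With \<open>t = logistic c x\<close> one has \<open>dt/dx = t (1 - t)\<close>, and the system becomes
  \<open>t (1 - t) dX/dt = (P - t Q) X\<close>, of Fuchsian type at \<open>t = 0\<close>. Comparing coefficients in
  \<open>X = \<Sum> t^n Y n\<close> gives \<open>(n + 1 - P) Y (n+1) = (n - Q) Y n\<close> and \<open>P Y 0 = 0\<close>;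
  non-resonance is what allows the recursion to be solved.
\<close>

lemma logistic_ode_exists:
  fixes P Q :: "complex ^ 'n::finite ^ 'n"
  assumes PV: "P *v V = 0"
    and nonres: "\<And>n w. n \<ge> 1 \<Longrightarrow> P *v w = of_nat n *s w \<Longrightarrow> w = 0"
    and c: "c > 0"
  shows "\<exists>X. logistic_solution P Q c V X"
proof -
  have "\<exists>y. of_nat (Suc n) *s y - P *v y = of_nat n *s w - Q *v w" for n and w :: "complex ^ 'n"
    by (rule resolvent_equation_solvable) (use nonres[of "Suc n"] in auto)
  then obtain G where G: "\<And>n w. of_nat (Suc n) *s G n w - P *v G n w = of_nat n *s w - Q *v w"
    by metis
  define Y where "Y = rec_nat V G"
  have Y0: "Y 0 = V" and YS: "\<And>n. Y (Suc n) = G n (Y n)" by (auto simp: Y_def)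
  have rec: "of_nat (Suc n) *s Y (Suc n) - P *v Y (Suc n) = of_nat n *s Y n - Q *v Y n" for n
    unfolding YS by (rule G)
  note sm = recursion_power_series_summable[OF rec]
  have ofn: "of_nat k *s w = real k *\<^sub>R w" for k and w :: "complex ^ 'n"
    by (simp add: vec_eq_iff scaleR_conv_of_real[where 'a = complex])
  define F where "F = (\<lambda>i z. \<Sum>n. Y n $ i * z ^ n)"
  define F' where "F' = (\<lambda>i z. \<Sum>n. diffs (\<lambda>n. Y n $ i) n * z ^ n)"
  have smc: "summable (\<lambda>n. Y n $ i * z ^ n)" if "norm z < 1" for i and z :: complex
  proof -
    obtain r where r: "norm z < r" "r < 1" using \<open>norm z < 1\<close> dense by blast
    have "summable (\<lambda>n. (r ^ n *\<^sub>R Y n) $ i)"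
      using bounded_linear.summable[OF bounded_linear_vec_nth sm[of r]] r norm_ge_zero[of z]
      by auto
    then have "summable (\<lambda>n. Y n $ i * complex_of_real r ^ n)"
      by (simp add: scaleR_conv_of_real[where 'a = complex] mult.commute)
    then show ?thesis
      by (rule powser_inside) (use r norm_ge_zero[of z] in auto)
  qed
  have dF: "(F i has_field_derivative F' i z) (at z)" if "norm z < 1" for i z
    unfolding F_def F'_def by (rule termdiffs_strong'[of 1, OF smc that])
  define X where "X = (\<lambda>x. \<chi> i. F i (of_real (logistic c x)))"
  have ode: "(X has_vector_derivative (P *v X x - logistic c x *\<^sub>R (Q *v X x))) (at x)" for x
  proof (rule has_vector_derivative_vecI)
    fix i
    define t where "t = logistic c x"
    have t: "0 < t" "t < 1" using logistic_bounds[OF c] by (auto simp: t_def)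
    have X: "(\<lambda>n. t ^ n *\<^sub>R Y n) sums X x"
    proof -
      have "(\<Sum>n. t ^ n *\<^sub>R Y n) $ j = X x $ j" for j
        using bounded_linear.suminf[OF bounded_linear_vec_nth sm[of t], of j] t
        by (simp add: X_def F_def t_def[symmetric] scaleR_conv_of_real[where 'a = complex] mult.commute)
      then show ?thesis using sm[of t] t by (metis abs_of_pos summable_sums vec_eq_iff)
    qed
    have PX: "(\<lambda>n. t ^ n *\<^sub>R (P *v Y n) $ i) sums ((P *v X x) $ i)"
      using bounded_linear.sums[OF bounded_linear_compose[OF bounded_linear_vec_nth[of i]
          bounded_linear_matrix_vector[of P]] X]
      by (simp add: bounded_linear.linear[OF bounded_linear_matrix_vector] linear_scale)
    have QX: "(\<lambda>n. t ^ n *\<^sub>R (Q *v Y n) $ i) sums ((Q *v X x) $ i)"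
      using bounded_linear.sums[OF bounded_linear_compose[OF bounded_linear_vec_nth[of i]
          bounded_linear_matrix_vector[of Q]] X]
      by (simp add: bounded_linear.linear[OF bounded_linear_matrix_vector] linear_scale)
    have "summable (\<lambda>n. diffs (\<lambda>n. Y n $ i) n * complex_of_real t ^ n)"
      by (rule termdiff_converges[of _ 1]) (use t smc in auto)
    from summable_sums[OF this]
    have D: "(\<lambda>n. of_nat (Suc n) * Y (Suc n) $ i * of_real t ^ n) sums F' i (of_real t)"
      by (simp add: F'_def diffs_def)
    have D1: "(\<lambda>n. of_nat n * Y n $ i * of_real t ^ n) sums (of_real t * F' i (of_real t))"
      by (rule sums_Suc_imp) (use sums_mult[OF D, of "of_real t"] in \<open>simp_all add: algebra_simps\<close>)
    have c0: "(P *v Y 0) $ i = 0" using PV Y0 by simp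
    have PX1: "(\<lambda>n. of_real t ^ n * (P *v Y (Suc n)) $ i) sums ((P *v X x) $ i / of_real t)"
    proof -
      have "(\<lambda>n. t ^ Suc n *\<^sub>R (P *v Y (Suc n)) $ i) sums ((P *v X x) $ i)"
        using PX c0 by (subst sums_Suc_iff) simp
      from sums_divide[OF this, of "of_real t"] show ?thesis
        using t by (simp add: scaleR_conv_of_real[where 'a = complex] field_simps)
    qed
    have "(\<lambda>n. of_nat (Suc n) * Y (Suc n) $ i * of_real t ^ n - of_nat n * Y n $ i * of_real t ^ n
             - of_real t ^ n * (P *v Y (Suc n)) $ i + t ^ n *\<^sub>R (Q *v Y n) $ i) sums
          (F' i (of_real t) - of_real t * F' i (of_real t) - (P *v X x) $ i / of_real t + (Q *v X x) $ i)"
      by (intro sums_add sums_diff D D1 PX1 QX)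
    moreover have "of_nat (Suc n) * Y (Suc n) $ i * of_real t ^ n - of_nat n * Y n $ i * of_real t ^ n
             - of_real t ^ n * (P *v Y (Suc n)) $ i + t ^ n *\<^sub>R (Q *v Y n) $ i = 0" for n
    proof -
      have "of_nat (Suc n) * Y (Suc n) $ i - (P *v Y (Suc n)) $ i - (of_nat n * Y n $ i - (Q *v Y n) $ i) = 0"
        using arg_cong[OF rec[of n], of "\<lambda>w. w $ i"] by (simp add: algebra_simps)
      then have "complex_of_real t ^ n * (of_nat (Suc n) * Y (Suc n) $ i - (P *v Y (Suc n)) $ i - (of_nat n * Y n $ i - (Q *v Y n) $ i)) = 0"
        by simp
      then show ?thesis by (simp add: scaleR_conv_of_real[where 'a = complex] algebra_simps)
    qed
    ultimately have "F' i (of_real t) - of_real t * F' i (of_real t) - (P *v X x) $ i / of_real t + (Q *v X x) $ i = 0"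
      by (simp add: sums_unique2[OF _ sums_zero])
    then have key: "of_real (t * (1 - t)) * F' i (of_real t) = (P *v X x - t *\<^sub>R (Q *v X x)) $ i"
      using t by (simp add: scaleR_conv_of_real[where 'a = complex] field_simps)
    have "((\<lambda>x. complex_of_real (logistic c x)) has_vector_derivative of_real (t * (1 - t))) (at x)"
      unfolding t_def by (rule has_vector_derivative_of_real[OF logistic_deriv[OF c]])
    from field_vector_diff_chain_at[OF this dF[of _ i]]
    have "((\<lambda>x. X x $ i) has_vector_derivative (of_real (t * (1 - t)) * F' i (of_real t))) (at x)"
      using t by (simp add: X_def o_def t_def)
    then show "((\<lambda>x. X x $ i) has_vector_derivative (P *v X x - logistic c x *\<^sub>R (Q *v X x)) $ i) (at x)"
      unfolding key unfolding t_def .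
  qed
  have "(X \<longlongrightarrow> V) at_bot"
  proof (rule vec_tendstoI)
    fix i
    have "isCont (F i) 0" using dF[of 0 i] DERIV_isCont by auto
    moreover have "((\<lambda>x. complex_of_real (logistic c x)) \<longlongrightarrow> 0) at_bot"
      using tendsto_of_real[OF logistic_tendsto_0[OF c]] by simp
    ultimately have "((\<lambda>x. F i (of_real (logistic c x))) \<longlongrightarrow> F i 0) at_bot"
      by (rule isCont_tendsto_compose)
    moreover have "F i 0 = V $ i" using Y0 by (simp add: F_def)
    ultimately show "((\<lambda>x. X x $ i) \<longlongrightarrow> V $ i) at_bot" by (simp add: X_def)
  qed
  with ode show ?thesis unfolding logistic_solution_def by blast
qed

section \<open>Uniqueness of solutions with a prescribed limit\<close>

lemma gronwall_norm_sq:
  fixes X :: "real \<Rightarrow> 'a::real_inner"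
  assumes d: "\<And>x. (X has_vector_derivative D x) (at x)"
    and K: "\<And>x. norm (D x) \<le> K * norm (X x)" and xy: "x \<le> y"
  shows "(norm (X y))\<^sup>2 \<le> exp (2 * K * (y - x)) * (norm (X x))\<^sup>2"
    and "(norm (X x))\<^sup>2 \<le> exp (2 * K * (y - x)) * (norm (X y))\<^sup>2"
proof -
  have E: "((\<lambda>x. X x \<bullet> X x) has_real_derivative 2 * (X z \<bullet> D z)) (at z)" for z
    using d[of z] unfolding has_vector_derivative_def has_field_derivative_def
    by (auto intro!: derivative_eq_intros simp: fun_eq_iff inner_commute algebra_simps)
  have b: "\<bar>X z \<bullet> D z\<bar> \<le> K * (X z \<bullet> X z)" for z
  proof -
    have "\<bar>X z \<bullet> D z\<bar> \<le> norm (X z) * norm (D z)" by (rule Cauchy_Schwarz_ineq2)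
    also have "\<dots> \<le> norm (X z) * (K * norm (X z))" by (rule mult_left_mono[OF K]) simp
    finally show ?thesis by (simp add: dot_square_norm power2_eq_square mult_ac)
  qed
  have mono: "exp (k * y) * (X y \<bullet> X y) \<ge> exp (k * x) * (X x \<bullet> X x)" if "k = 2 * K" for k
  proof (rule DERIV_nonneg_imp_nondecreasing[OF xy], intro exI conjI)
    fix z
    show "((\<lambda>z. exp (k * z) * (X z \<bullet> X z)) has_real_derivative
        exp (k * z) * (2 * (X z \<bullet> D z) + k * (X z \<bullet> X z))) (at z)"
      by (rule derivative_eq_intros E refl | simp add: algebra_simps)+
    show "exp (k * z) * (2 * (X z \<bullet> D z) + k * (X z \<bullet> X z)) \<ge> 0"
      using b[of z] that by (intro mult_nonneg_nonneg) auto
  qed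
  have anti: "exp (- k * y) * (X y \<bullet> X y) \<le> exp (- k * x) * (X x \<bullet> X x)" if "k = 2 * K" for k
  proof (rule DERIV_nonpos_imp_nonincreasing[OF xy], intro exI conjI)
    fix z
    show "((\<lambda>z. exp (- k * z) * (X z \<bullet> X z)) has_real_derivative
        exp (- k * z) * (2 * (X z \<bullet> D z) - k * (X z \<bullet> X z))) (at z)"
      by (rule derivative_eq_intros E refl | simp add: algebra_simps)+
    show "exp (- k * z) * (2 * (X z \<bullet> D z) - k * (X z \<bullet> X z)) \<le> 0"
      using b[of z] that by (intro mult_nonneg_nonpos) auto
  qed
  show "(norm (X y))\<^sup>2 \<le> exp (2 * K * (y - x)) * (norm (X x))\<^sup>2"
    using anti[OF refl] by (simp add: dot_square_norm exp_diff exp_minus field_simps)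
  show "(norm (X x))\<^sup>2 \<le> exp (2 * K * (y - x)) * (norm (X y))\<^sup>2"
    using mono[OF refl] by (simp add: dot_square_norm exp_diff exp_minus field_simps)
qed

text \<open>
  The coefficients are bounded, so Gronwall's inequality run backwards from \<open>0\<close> makes the
  solution vanish on the half line that determines its limit.
\<close>

lemma logistic_solution_zero:
  assumes X: "logistic_solution P Q c V X" and c: "c > 0" and X0: "X 0 = 0"
  shows "V = 0"
proof -
  obtain K where K: "K > 0" "\<And>w. norm (P *v w) \<le> norm w * K"
    using bounded_linear.pos_bounded[OF bounded_linear_matrix_vector[of P]] by blast
  obtain L where L: "L > 0" "\<And>w. norm (Q *v w) \<le> norm w * L"
    using bounded_linear.pos_bounded[OF bounded_linear_matrix_vector[of Q]] by blast
  have d: "\<And>x. (X has_vector_derivative (P *v X x - logistic c x *\<^sub>R (Q *v X x))) (at x)"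
    and lim: "(X \<longlongrightarrow> V) at_bot"
    using X by (auto simp: logistic_solution_def)
  have b: "norm (P *v X x - logistic c x *\<^sub>R (Q *v X x)) \<le> (K + L) * norm (X x)" for x
  proof -
    have "norm (P *v X x - logistic c x *\<^sub>R (Q *v X x)) \<le> norm (P *v X x) + norm (logistic c x *\<^sub>R (Q *v X x))"
      by (rule norm_triangle_ineq4)
    also have "\<dots> \<le> norm (X x) * K + 1 * (norm (X x) * L)"
      unfolding norm_scaleR using logistic_bounds[OF c, of x] K(2) L
      by (intro add_mono mult_mono) auto
    finally show ?thesis by (simp add: algebra_simps)
  qed
  have "X x = 0" if "x \<le> 0" for x
    using gronwall_norm_sq(2)[OF d b that] X0 by simp
  then have "\<forall>\<^sub>F x in at_bot. X x = 0"
    by (rule eventually_mono[OF eventually_le_at_bot])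
  then have "(X \<longlongrightarrow> 0) at_bot" by (rule tendsto_eventually)
  then show ?thesis using lim tendsto_unique trivial_limit_at_bot_linorder by blast
qed

lemma logistic_solution_diff:
  assumes "logistic_solution P Q c V X" "logistic_solution P Q c V' Y"
  shows "logistic_solution P Q c (V - V') (\<lambda>x. X x - Y x)"
  using assms unfolding logistic_solution_def
  by (auto intro!: tendsto_intros derivative_eq_intros simp: matrix_vector_mult_diff_distrib algebra_simps)

text \<open>
  Because \<open>Re p \<le> 0\<close>, the homogeneous solution \<open>exp (p x)\<close> does not decay at \<open>-\<infinity>\<close>. Hence
  \<open>exp (-p x) y\<close> still tends to \<open>0\<close> and equals the integral of \<open>exp (-p x) g\<close> from
  \<open>-\<infinity>\<close>, which transfers the decay rate of the forcing to \<open>y\<close>.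
\<close>

lemma scalar_forced_decay:
  fixes y g :: "real \<Rightarrow> complex"
  assumes d: "\<And>x. (y has_vector_derivative (p * y x + g x)) (at x)"
    and p: "Re p \<le> 0" and lim: "(y \<longlongrightarrow> 0) at_bot"
    and g: "\<And>x. x \<le> X0 \<Longrightarrow> norm (g x) \<le> C * exp (\<sigma> * x)" and \<sigma>: "\<sigma> > 0" and x: "x \<le> X0"
  shows "norm (y x) \<le> C / \<sigma> * exp (\<sigma> * x)"
proof -
  define h where "h = (\<lambda>x. exp (- p * of_real x) * y x)"
  define \<phi> where "\<phi> = (\<lambda>x. C / (\<sigma> - Re p) * exp ((\<sigma> - Re p) * x))"
  have C: "C \<ge> 0"
  proof -
    have "0 \<le> C * exp (\<sigma> * X0)" using g[of X0] norm_ge_zero order_trans by blast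
    then show ?thesis by (simp add: zero_le_mult_iff)
  qed
  have dh: "(h has_vector_derivative (exp (- p * of_real z) * g z)) (at z)" for z
    unfolding h_def using has_vector_derivative_mult[OF has_vector_derivative_exp_of_real[of "- p" z] d[of z]]
    by (simp add: algebra_simps)
  have d\<phi>: "(\<phi> has_vector_derivative (C * exp ((\<sigma> - Re p) * z))) (at z)" for z
    unfolding \<phi>_def has_real_derivative_iff_has_vector_derivative[symmetric]
    using p \<sigma> by (auto intro!: derivative_eq_intros)
  have bound: "norm (h x) \<le> \<phi> x + norm (h a)" if a: "a < x" for a
  proof -
    have "norm (h x - h a) \<le> \<phi> x - \<phi> a"
    proof (rule differentiable_bound_general[OF a])
      show "continuous_on {a..x} h" "continuous_on {a..x} \<phi>"
        by (rule continuous_at_imp_continuous_on ballI has_vector_derivative_continuous dh d\<phi>)+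
      fix z assume z: "a < z" "z < x"
      have "norm (exp (- p * of_real z) * g z) \<le> exp (- Re p * z) * (C * exp (\<sigma> * z))"
        using g[of z] z x by (simp add: norm_mult)
      also have "\<dots> = C * exp ((\<sigma> - Re p) * z)" by (simp add: exp_add[symmetric] algebra_simps)
      finally show "norm (exp (- p * of_real z) * g z) \<le> C * exp ((\<sigma> - Re p) * z)" .
    qed (use dh d\<phi> in auto)
    moreover have "\<phi> a \<ge> 0" using C p \<sigma> by (simp add: \<phi>_def)
    moreover have "norm (h x) \<le> norm (h x - h a) + norm (h a)"
      using norm_triangle_ineq[of "h x - h a" "h a"] by simp
    ultimately show ?thesis by linarith
  qed
  have "(h \<longlongrightarrow> 0) at_bot"
  proof (rule tendsto_norm_zero_cancel, rule tendsto_sandwich)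
    show "((\<lambda>_. 0::real) \<longlongrightarrow> 0) at_bot" by simp
    show "((\<lambda>x. norm (y x)) \<longlongrightarrow> 0) at_bot" using lim by (rule tendsto_norm_zero)
    show "\<forall>\<^sub>F x in at_bot. norm (h x) \<le> norm (y x)"
    proof (rule eventually_mono[OF eventually_le_at_bot[of 0]])
      fix x :: real assume "x \<le> 0"
      then have "exp (- Re p * x) \<le> 1" using p by (simp add: mult_nonpos_nonpos)
      then show "norm (h x) \<le> norm (y x)"
        using mult_right_mono[of "exp (- Re p * x)" 1 "norm (y x)"] by (simp add: h_def norm_mult)
    qed
  qed simp
  then have "((\<lambda>a. \<phi> x + norm (h a)) \<longlongrightarrow> \<phi> x + 0) at_bot"
    by (intro tendsto_intros tendsto_norm_zero)
  then have "norm (h x) \<le> \<phi> x + 0"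
    by (rule tendsto_lowerbound)
      (use bound in \<open>auto intro: eventually_mono[OF eventually_gt_at_bot]
        simp: eventually_at_bot_dense\<close>)
  then have "exp (- Re p * x) * norm (y x) \<le> C / (\<sigma> - Re p) * exp ((\<sigma> - Re p) * x)"
    by (simp add: h_def \<phi>_def norm_mult)
  then have "exp (- Re p * x) * norm (y x) \<le> exp (- Re p * x) * (C / (\<sigma> - Re p) * exp (\<sigma> * x))"
    by (simp add: exp_add[symmetric] algebra_simps)
  then have "norm (y x) \<le> C / (\<sigma> - Re p) * exp (\<sigma> * x)"
    by (rule mult_left_le_imp_le) simp
  also have "\<dots> \<le> C / \<sigma> * exp (\<sigma> * x)"
    using C p \<sigma> by (intro mult_right_mono divide_left_mono) auto
  finally show ?thesis .
qed

text \<open>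
  Bootstrapping: if the three functions are \<open>O(exp (n x))\<close> at \<open>-\<infinity>\<close>, the perturbation, which carries
  the factor \<open>t = O(exp x)\<close>, is \<open>O(exp ((n+1) x))\<close>; solving the triangular system from the
  first equation to the last passes this rate on to all three. By Gronwall's inequality a nonzero
  solution of a linear system with bounded coefficients cannot decay faster than every exponential.
  The triangular form covers nilpotent blocks of the limiting matrix as well.
\<close>

lemma triangular_system_unique:
  fixes f1 f2 f3 g1 g2 g3 :: "real \<Rightarrow> complex" and t :: "real \<Rightarrow> real"
  assumes d1: "\<And>x. (f1 has_vector_derivative (p1 * f1 x + t x *\<^sub>R g1 x)) (at x)"
    and d2: "\<And>x. (f2 has_vector_derivative (p2 * f2 x + (m21 * f1 x + t x *\<^sub>R g2 x))) (at x)"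
    and d3: "\<And>x. (f3 has_vector_derivative (p3 * f3 x + (m31 * f1 x + m32 * f2 x + t x *\<^sub>R g3 x))) (at x)"
    and p: "Re p1 \<le> 0" "Re p2 \<le> 0" "Re p3 \<le> 0"
    and g: "\<And>x. norm (g1 x) \<le> K * (norm (f1 x) + norm (f2 x) + norm (f3 x))"
      "\<And>x. norm (g2 x) \<le> K * (norm (f1 x) + norm (f2 x) + norm (f3 x))"
      "\<And>x. norm (g3 x) \<le> K * (norm (f1 x) + norm (f2 x) + norm (f3 x))"
    and t: "\<And>x. 0 \<le> t x" "\<And>x. t x \<le> 1" "\<And>x. t x \<le> T * exp x"
    and lim: "(f1 \<longlongrightarrow> 0) at_bot" "(f2 \<longlongrightarrow> 0) at_bot" "(f3 \<longlongrightarrow> 0) at_bot"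
  shows "f1 x = 0 \<and> f2 x = 0 \<and> f3 x = 0"
proof -
  define N where "N = (\<lambda>x. norm (f1 x) + norm (f2 x) + norm (f3 x))"
  define L where "L = \<bar>K\<bar>"
  have L: "L \<ge> 0" by (simp add: L_def)
  have N0: "N x \<ge> 0" for x by (simp add: N_def)
  have gL: "norm (g1 x) \<le> L * N x" "norm (g2 x) \<le> L * N x" "norm (g3 x) \<le> L * N x" for x
    using g[of x] mult_right_mono[OF abs_ge_self[of K] N0[of x]] by (auto simp: N_def L_def)
  have T: "T \<ge> 0" using t(1)[of 0] t(3)[of 0] by simp
  have "(N \<longlongrightarrow> 0) at_bot"
    unfolding N_def using tendsto_add[OF tendsto_add[OF lim(1,2)[THEN tendsto_norm_zero]] lim(3)[THEN tendsto_norm_zero]]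
    by simp
  then have "\<forall>\<^sub>F x in at_bot. N x < 1" by (rule order_tendstoD) simp
  then obtain X0 where X0: "\<And>x. x \<le> X0 \<Longrightarrow> N x < 1" by (auto simp: eventually_at_bot_linorder)
  have boot: "\<exists>C\<ge>0. \<forall>x\<le>X0. N x \<le> C * exp (real n * x)" for n
  proof (induction n)
    case 0
    show ?case using X0 by (intro exI[of _ 1]) (auto intro: less_imp_le)
  next
    case (Suc n)
    then obtain C where C: "C \<ge> 0" "\<And>x. x \<le> X0 \<Longrightarrow> N x \<le> C * exp (real n * x)" by blast
    define \<sigma> where "\<sigma> = real (Suc n)"
    have \<sigma>: "\<sigma> > 0" by (simp add: \<sigma>_def)
    define G where "G = T * L * C"
    have G0: "G \<ge> 0" using T L C by (simp add: G_def)
    have tg: "norm (t x *\<^sub>R w) \<le> G * exp (\<sigma> * x)" if "norm w \<le> L * N x" "x \<le> X0" for w :: complex and x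
    proof -
      have "norm w \<le> L * (C * exp (real n * x))"
        using that(1) mult_left_mono[OF C(2)[OF that(2)] L] by simp
      then have "norm (t x *\<^sub>R w) \<le> (T * exp x) * (L * (C * exp (real n * x)))"
        using t(1,3)[of x] T by (simp add: mult_mono)
      also have "\<dots> = G * exp (\<sigma> * x)"
        by (simp add: G_def \<sigma>_def exp_add algebra_simps)
      finally show ?thesis .
    qed
    have b1: "norm (f1 x) \<le> G / \<sigma> * exp (\<sigma> * x)" if "x \<le> X0" for x
      by (rule scalar_forced_decay[OF d1 p(1) lim(1) _ \<sigma> that]) (use tg gL in auto)
    have mb: "norm (q * w) \<le> norm q * B" if "norm w \<le> B" for q w :: complex and B
      using that by (simp add: norm_mult mult_left_mono)
    define G2 where "G2 = norm m21 * (G / \<sigma>) + G"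
    have b2: "norm (f2 x) \<le> G2 / \<sigma> * exp (\<sigma> * x)" if "x \<le> X0" for x
    proof (rule scalar_forced_decay[OF d2 p(2) lim(2) _ \<sigma> that])
      fix x assume x: "x \<le> X0"
      have "norm (m21 * f1 x + t x *\<^sub>R g2 x) \<le> norm m21 * (G / \<sigma> * exp (\<sigma> * x)) + G * exp (\<sigma> * x)"
        by (intro norm_triangle_mono mb b1 tg gL x)
      then show "norm (m21 * f1 x + t x *\<^sub>R g2 x) \<le> G2 * exp (\<sigma> * x)"
        by (simp add: G2_def algebra_simps)
    qed
    define G3 where "G3 = norm m31 * (G / \<sigma>) + norm m32 * (G2 / \<sigma>) + G"
    have b3: "norm (f3 x) \<le> G3 / \<sigma> * exp (\<sigma> * x)" if "x \<le> X0" for x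
    proof (rule scalar_forced_decay[OF d3 p(3) lim(3) _ \<sigma> that])
      fix x assume x: "x \<le> X0"
      have "norm (m31 * f1 x + m32 * f2 x + t x *\<^sub>R g3 x) \<le> norm m31 * (G / \<sigma> * exp (\<sigma> * x))
           + norm m32 * (G2 / \<sigma> * exp (\<sigma> * x)) + G * exp (\<sigma> * x)"
        by (intro norm_triangle_mono mb b1 b2 tg gL x)
      then show "norm (m31 * f1 x + m32 * f2 x + t x *\<^sub>R g3 x) \<le> G3 * exp (\<sigma> * x)"
        by (simp add: G3_def algebra_simps)
    qed
    have "N x \<le> (G / \<sigma> + G2 / \<sigma> + G3 / \<sigma>) * exp (\<sigma> * x)" if "x \<le> X0" for x
      using b1[OF that] b2[OF that] b3[OF that] by (simp add: N_def distrib_right)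
    moreover have "0 \<le> G / \<sigma> + G2 / \<sigma> + G3 / \<sigma>"
      using G0 \<sigma> by (simp add: G2_def G3_def)
    ultimately show ?case unfolding \<sigma>_def by blast
  qed
  define X where "X = (\<lambda>x. (f1 x, f2 x, f3 x))"
  define D where "D = (\<lambda>x. (p1 * f1 x + t x *\<^sub>R g1 x, p2 * f2 x + (m21 * f1 x + t x *\<^sub>R g2 x),
      p3 * f3 x + (m31 * f1 x + m32 * f2 x + t x *\<^sub>R g3 x)))"
  \<comment> \<open>\<open>M\<close> bounds the coefficients of the whole system; its outer factor \<open>3\<close> compares the sum of moduli with the product norm.\<close>
  define M where "M = 3 * (norm p1 + norm p2 + norm p3 + norm m21 + norm m31 + norm m32 + 3 * L)"
  have M: "M \<ge> 0" using L by (simp add: M_def)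
  have NX: "N x \<le> 3 * norm (X x)" "norm (X x) \<le> N x" for x
    using norm_fst_le[of "f1 x" "(f2 x, f3 x)"] norm_snd_le[of "(f2 x, f3 x)" "f1 x"]
      norm_fst_le[of "f2 x" "f3 x"] norm_snd_le[of "f3 x" "f2 x"]
      norm_Pair_le[of "f1 x" "(f2 x, f3 x)"] norm_Pair_le[of "f2 x" "f3 x"]
    unfolding N_def X_def by linarith+
  have dX: "(X has_vector_derivative D x) (at x)" for x
    unfolding X_def D_def by (intro has_vector_derivative_Pair d1 d2 d3)
  have DM: "norm (D x) \<le> M * norm (X x)" for x
  proof -
    have f: "norm (f1 x) \<le> N x" "norm (f2 x) \<le> N x" "norm (f3 x) \<le> N x" by (auto simp: N_def)
    have pf: "norm (q * w) \<le> norm q * N x" if "norm w \<le> N x" for q w :: complex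
      using that by (simp add: norm_mult mult_left_mono)
    have tg: "norm (t x *\<^sub>R w) \<le> L * N x" if "norm w \<le> L * N x" for w :: complex
      using mult_mono[OF t(2)[of x] that] t(1)[of x] by simp
    have "norm (D x) \<le> norm (p1 * f1 x + t x *\<^sub>R g1 x) + (norm (p2 * f2 x + (m21 * f1 x + t x *\<^sub>R g2 x))
        + norm (p3 * f3 x + (m31 * f1 x + m32 * f2 x + t x *\<^sub>R g3 x)))"
      unfolding D_def by (rule order_trans[OF norm_Pair_le add_left_mono[OF norm_Pair_le]])
    also have "\<dots> \<le> (norm p1 * N x + L * N x) + ((norm p2 * N x + (norm m21 * N x + L * N x))
        + (norm p3 * N x + (norm m31 * N x + norm m32 * N x + L * N x)))"
      by (intro add_mono norm_triangle_mono pf f tg gL)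
    also have "\<dots> = M / 3 * N x" by (simp add: M_def algebra_simps)
    also have "\<dots> \<le> M / 3 * (3 * norm (X x))" using M NX(1) by (intro mult_left_mono) auto
    finally show ?thesis by simp
  qed
  obtain n :: nat where n: "real n > M" using reals_Archimedean2 by blast
  obtain C where C: "C \<ge> 0" "\<And>x. x \<le> X0 \<Longrightarrow> N x \<le> C * exp (real n * x)" using boot by blast
  have "(norm (X x))\<^sup>2 \<le> 0"
  proof (rule tendsto_lowerbound)
    have "((\<lambda>a. exp ((2 * (real n - M)) * a)) \<longlongrightarrow> 0) at_bot"
      using n by (intro filterlim_compose[OF exp_at_bot] filterlim_tendsto_pos_mult_at_bot[OF tendsto_const])
        (auto simp: filterlim_ident)
    then show "((\<lambda>a. exp (2 * M * x) * C\<^sup>2 * exp ((2 * (real n - M)) * a)) \<longlongrightarrow> 0) at_bot"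
      by (rule tendsto_mult_right_zero)
    show "\<forall>\<^sub>F a in at_bot. (norm (X x))\<^sup>2 \<le> exp (2 * M * x) * C\<^sup>2 * exp ((2 * (real n - M)) * a)"
    proof (rule eventually_mono[OF eventually_le_at_bot[of "min x X0"]])
      fix a assume a: "a \<le> min x X0"
      have "(norm (X x))\<^sup>2 \<le> exp (2 * M * (x - a)) * (norm (X a))\<^sup>2"
        by (rule gronwall_norm_sq(1)[OF dX DM]) (use a in simp)
      also have "\<dots> \<le> exp (2 * M * (x - a)) * (C * exp (real n * a))\<^sup>2"
        using NX(2)[of a] C(2)[of a] a by (intro mult_left_mono power_mono) auto
      also have "\<dots> = exp (2 * M * x) * C\<^sup>2 * exp ((2 * (real n - M)) * a)"
      proof -
        have "(exp (real n * a))\<^sup>2 = exp (2 * real n * a)"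
          by (simp add: exp_double[symmetric] mult.assoc)
        moreover have "exp (2 * M * (x - a)) * exp (2 * real n * a) = exp (2 * M * x) * exp ((2 * (real n - M)) * a)"
          unfolding exp_add[symmetric] by (simp add: algebra_simps)
        ultimately show ?thesis by (simp add: power_mult_distrib mult_ac)
      qed
      finally show "(norm (X x))\<^sup>2 \<le> exp (2 * M * x) * C\<^sup>2 * exp ((2 * (real n - M)) * a)" .
    qed
  qed simp
  then show ?thesis by (simp add: X_def zero_prod_def)
qed

section \<open>The profile\<close>

lemma linear_ode_zero:
  fixes h a :: "real \<Rightarrow> real"
  assumes d: "\<And>x. (h has_real_derivative a x * h x) (at x)"
    and a: "continuous_on UNIV a" and h0: "h 0 = 0"
  shows "h x = 0"
proof -
  let ?S = "{- \<bar>x\<bar>..\<bar>x\<bar>}"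
  have "continuous_on ?S a" using a continuous_on_subset by blast
  then obtain g where g: "\<And>z. z \<in> ?S \<Longrightarrow> (g has_real_derivative a z) (at z within ?S)"
    unfolding has_real_derivative_iff_has_vector_derivative by (rule antiderivative_continuous) blast
  have "((\<lambda>z. h z * exp (- g z)) has_vector_derivative 0) (at z within ?S)" if "z \<in> ?S" for z
    unfolding has_real_derivative_iff_has_vector_derivative[symmetric]
    by (rule derivative_eq_intros DERIV_subset[OF d] g[OF that] refl | simp add: algebra_simps)+
  then obtain k where k: "\<And>z. z \<in> ?S \<Longrightarrow> h z * exp (- g z) = k"
    using has_vector_derivative_zero_constant[of ?S "\<lambda>z. h z * exp (- g z)"]
    by (auto simp: convex_real_interval)
  have "h x * exp (- g x) = h 0 * exp (- g 0)"
  proof -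
    have "x \<in> ?S" "0 \<in> ?S" by (auto simp: abs_if)
    then show ?thesis using k by metis
  qed
  then show ?thesis using h0 by simp
qed

lemma vhat_ode_solution:
  assumes "0 < v0" "v0 < 1"
  shows "((\<lambda>x. logistic ((1 - v0) / v0) (- x)) has_real_derivative
      logistic ((1 - v0) / v0) (- x) * (logistic ((1 - v0) / v0) (- x) - 1)) (at x)"
  using DERIV_chain2[OF logistic_deriv DERIV_minus[OF DERIV_ident], of "(1 - v0) / v0" x] assms
  by (simp add: algebra_simps)

text \<open>
  Two solutions \<open>u\<close>, \<open>v\<close> of the profile equation have a difference \<open>h = u - v\<close> satisfying the linear
  equation \<open>h' = (u + v - 1) h\<close>, which gives the uniqueness that the definite description requires.
\<close>

lemma vhat_eq:
  assumes "0 < v0" "v0 < 1"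
  shows "vhat v0 x = logistic ((1 - v0) / v0) (- x)"
proof -
  let ?v = "\<lambda>x. logistic ((1 - v0) / v0) (- x)"
  have "vhat v0 = ?v"
    unfolding vhat_def
  proof (rule the_equality)
    show "(\<forall>x. (?v has_real_derivative ?v x * (?v x - 1)) (at x)) \<and> ?v 0 = v0"
      using vhat_ode_solution[OF assms] logistic_at_0[OF assms(1)] by auto
  next
    fix u assume u: "(\<forall>x. (u has_real_derivative u x * (u x - 1)) (at x)) \<and> u 0 = v0"
    show "u = ?v"
    proof
      fix x
      have "u x - ?v x = 0"
      proof (rule linear_ode_zero[of "\<lambda>x. u x - ?v x" "\<lambda>x. u x + ?v x - 1"])
        fix x
        show "((\<lambda>x. u x - ?v x) has_real_derivative (u x + ?v x - 1) * (u x - ?v x)) (at x)"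
          using DERIV_diff[OF u[THEN conjunct1, rule_format, of x] vhat_ode_solution[OF assms, of x]]
          by (simp add: algebra_simps)
        show "continuous_on UNIV (\<lambda>x. u x + ?v x - 1)"
          by (intro continuous_at_imp_continuous_on ballI continuous_intros
              DERIV_isCont[OF u[THEN conjunct1, rule_format]] DERIV_isCont[OF vhat_ode_solution[OF assms]])
        show "u 0 - ?v 0 = 0" using u logistic_at_0[OF assms(1)] by simp
      qed
      then show "u x = ?v x" by simp
    qed
  qed
  then show ?thesis by simp
qed

lemma vhat_complement:
  assumes "0 < v0" "v0 < 1"
  shows "vhat v0 x = 1 - logistic (v0 / (1 - v0)) x"
  using logistic_reflect[of "(1 - v0) / v0" x] assms by (simp add: vhat_eq)

section \<open>Inflow: the dual solution\<close>

text \<open>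
  In the variable \<open>-x\<close> the dual system has coefficient matrix equal to the adjoint of
  \<open>A0\<close>, which is \<open>inflow_limit m - v inflow_coupling\<close> with \<open>m\<close> the conjugate of \<open>\<lambda>\<close>
  and \<open>v\<close> the profile. The limit is lower triangular with a nilpotent block for the double
  eigenvalue \<open>0\<close>.
\<close>

definition inflow_limit :: "complex \<Rightarrow> complex ^ 3 ^ 3" where
  "inflow_limit m = vector [vector [0, 0, 0], vector [m, 0, 0], vector [m, m, - 1 - m]]"

definition inflow_coupling :: "complex ^ 3 ^ 3" where
  "inflow_coupling = vector [vector [0, 0, - 1], vector [0, 0, - 1], vector [0, 0, - 2]]"

lemma adjoint_system_reflected:
  assumes "0 < v0" "v0 < 1"
  shows "- cadjoint (A0 v0 (- x) l) *v w =
    - (inflow_limit (cnj l) *v w - logistic ((1 - v0) / v0) x *\<^sub>R (inflow_coupling *v w))"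
  by (simp add: vec3_eq_iff matrix_vector_mult_3 cadjoint_def A0_def Let_def vhat_eq[OF assms] inflow_limit_def inflow_coupling_def
      scaleR_conv_of_real[where 'a = complex])
    (simp add: algebra_simps)

lemma inflow_components:
  assumes "logistic_solution (inflow_limit m) inflow_coupling c V X"
  shows "((\<lambda>x. X x $ 1) has_vector_derivative (logistic c x *\<^sub>R X x $ 3)) (at x)"
    and "((\<lambda>x. X x $ 2) has_vector_derivative (m * X x $ 1 + logistic c x *\<^sub>R X x $ 3)) (at x)"
    and "((\<lambda>x. X x $ 3) has_vector_derivative
       ((- 1 - m) * X x $ 3 + (m * X x $ 1 + m * X x $ 2 + logistic c x *\<^sub>R (2 * X x $ 3)))) (at x)"
proof -
  have d: "(X has_vector_derivative (inflow_limit m *v X x - logistic c x *\<^sub>R (inflow_coupling *v X x))) (at x)" 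
    using assms by (simp add: logistic_solution_def)
  note e = has_vector_derivative_vec_nth[OF d]
  show "((\<lambda>x. X x $ 1) has_vector_derivative (logistic c x *\<^sub>R X x $ 3)) (at x)"
    using e[of 1] by (simp add: matrix_vector_mult_3 inflow_limit_def inflow_coupling_def)
  show "((\<lambda>x. X x $ 2) has_vector_derivative (m * X x $ 1 + logistic c x *\<^sub>R X x $ 3)) (at x)"
    using e[of 2] by (simp add: matrix_vector_mult_3 inflow_limit_def inflow_coupling_def)
  show "((\<lambda>x. X x $ 3) has_vector_derivative
       ((- 1 - m) * X x $ 3 + (m * X x $ 1 + m * X x $ 2 + logistic c x *\<^sub>R (2 * X x $ 3)))) (at x)"
    using e[of 3] by (simp add: matrix_vector_mult_3 inflow_limit_def inflow_coupling_def algebra_simps)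
qed

lemma inflow_unique:
  assumes X: "logistic_solution (inflow_limit m) inflow_coupling c 0 X" and m: "Re m \<ge> 0" and c: "c > 0"
  shows "X x = 0"
proof -
  have lim: "((\<lambda>x. X x $ i) \<longlongrightarrow> 0) at_bot" for i
    using X tendsto_vec_nth[of X 0 at_bot i] by (simp add: logistic_solution_def)
  have "X x $ 1 = 0 \<and> X x $ 2 = 0 \<and> X x $ 3 = 0"
  proof (rule triangular_system_unique[where ?f1.0 = "\<lambda>x. X x $ 1" and ?f2.0 = "\<lambda>x. X x $ 2" and ?f3.0 = "\<lambda>x. X x $ 3"
      and t = "logistic c" and ?p1.0 = 0 and ?p2.0 = 0 and ?p3.0 = "- 1 - m" and ?m21.0 = m and ?m31.0 = m and ?m32.0 = m
      and ?g1.0 = "\<lambda>x. X x $ 3" and ?g2.0 = "\<lambda>x. X x $ 3" and ?g3.0 = "\<lambda>x. 2 * X x $ 3" and K = 2 and T = "1 / c"])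
  qed (use inflow_components[OF X] m c lim logistic_bounds[OF c] logistic_le_exp[OF c] in
      \<open>auto simp: norm_mult intro: less_imp_le\<close>)
  then show ?thesis by (simp add: vec3_eq_iff)
qed

text \<open>
  The eigenvalues of \<open>inflow_limit m\<close> are \<open>0\<close>, \<open>0\<close>, \<open>-1 - m\<close>, none of them a positive
  integer nor of positive real part: existence and uniqueness both apply.
\<close>

lemma W1_in_reflected:
  assumes v0: "0 < v0" "v0 < 1" and l: "Re l \<ge> 0"
  shows "logistic_solution (inflow_limit (cnj l)) inflow_coupling ((1 - v0) / v0)
     (vector [0, - 1, cnj l / (- 1 - cnj l)]) (\<lambda>x. W1_in v0 l (- x))"
proof -
  define c where "c = (1 - v0) / v0"
  have c: "c > 0" using v0 by (simp add: c_def)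
  let ?m = "cnj l" and ?V = "vector [0, - 1, cnj l / (- 1 - cnj l)] :: complex ^ 3"
  let ?ls = "logistic_solution (inflow_limit ?m) inflow_coupling c ?V"
  let ?char = "\<lambda>W. solves_linear (\<lambda>x. - cadjoint (A0 v0 x l)) W \<and>
     (let \<mu> = - 1 - l in (W \<longlongrightarrow> vector [0, - 1, cnj l / cnj \<mu>]) at_top)"
  have iff: "?char W \<longleftrightarrow> ?ls (\<lambda>x. W (- x))" for W
  proof -
    have "solves_linear (\<lambda>x. - cadjoint (A0 v0 x l)) W \<longleftrightarrow>
      (\<forall>x. ((\<lambda>x. W (- x)) has_vector_derivative
         (inflow_limit ?m *v W (- x) - logistic c x *\<^sub>R (inflow_coupling *v W (- x)))) (at x))" (is "?L \<longleftrightarrow> ?R")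
    proof
      assume L: ?L
      show ?R
      proof
        fix x
        have "(W has_vector_derivative (- cadjoint (A0 v0 (- x) l) *v W (- x))) (at (- x))"
          using L by (simp add: solves_linear_def)
        from has_vector_derivative_reflect[OF this]
        show "((\<lambda>x. W (- x)) has_vector_derivative
         (inflow_limit ?m *v W (- x) - logistic c x *\<^sub>R (inflow_coupling *v W (- x)))) (at x)"
          unfolding adjoint_system_reflected[OF v0] c_def by simp
      qed
    next
      assume R: ?R
      show ?L unfolding solves_linear_def
      proof
        fix x
        show "(W has_vector_derivative (- cadjoint (A0 v0 x l) *v W x)) (at x)"
          using has_vector_derivative_reflect[OF R[rule_format, of "- x"]]
            adjoint_system_reflected[OF v0, of "- x" l "W x"]
          by (simp add: c_def)
      qed
    qed
    moreover have "(W \<longlongrightarrow> ?V) at_top \<longleftrightarrow> ((\<lambda>x. W (- x)) \<longlongrightarrow> ?V) at_bot"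
      by (simp add: at_bot_mirror filterlim_filtermap)
    ultimately show ?thesis by (simp add: logistic_solution_def Let_def)
  qed
  have m1: "- 1 - ?m \<noteq> 0" using l by (auto simp: complex_eq_iff)
  have PV: "inflow_limit ?m *v ?V = 0"
    using m1 by (simp add: vec3_eq_iff matrix_vector_mult_3 inflow_limit_def)
  have "w = 0" if n: "n \<ge> 1" and w: "inflow_limit ?m *v w = of_nat n *s w" for n and w :: "complex ^ 3"
  proof -
    have n0: "of_nat n \<noteq> (0 :: complex)" using n by simp
    have "w $ 1 = 0" using w n0 by (simp add: vec3_eq_iff matrix_vector_mult_3 inflow_limit_def)
    moreover from this have "w $ 2 = 0" using w n0 by (simp add: vec3_eq_iff matrix_vector_mult_3 inflow_limit_def)
    moreover have "- 1 - ?m \<noteq> of_nat n" using l n by (auto simp: complex_eq_iff)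
    then have "(- 1 - ?m - of_nat n) * w $ 3 = 0 \<longrightarrow> w $ 3 = 0" by auto
    ultimately show ?thesis using w by (simp add: vec3_eq_iff matrix_vector_mult_3 inflow_limit_def algebra_simps)
  qed
  then obtain X where X: "?ls X"
    using logistic_ode_exists[OF PV _ c] by blast
  have "W1_in v0 l = (\<lambda>x. X (- x))"
    unfolding W1_in_def
  proof (rule the_equality)
    show "?char (\<lambda>x. X (- x))" unfolding iff using X by simp
    fix W assume "?char W"
    then have "?ls (\<lambda>x. W (- x))" unfolding iff .
    from logistic_solution_diff[OF this X]
    have "W (- x) - X x = 0" for x
      using inflow_unique[of ?m c "\<lambda>x. W (- x) - X x" x] l c by simp
    from this[of "- x" for x] show "W = (\<lambda>x. X (- x))" by auto
  qed
  then show ?thesis using X by (simp add: c_def)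
qed

section \<open>Inflow: the energy estimate\<close>

lemma nondecreasing_from_zero:
  fixes \<Phi> :: "real \<Rightarrow> real"
  assumes d: "\<And>x. (\<Phi> has_real_derivative \<Phi>' x) (at x)" and pos: "\<And>x. \<Phi>' x \<ge> 0"
    and lim: "(\<Phi> \<longlongrightarrow> 0) at_bot"
  shows "\<Phi> x \<ge> 0"
proof (rule tendsto_upperbound[OF lim])
  show "\<forall>\<^sub>F a in at_bot. \<Phi> a \<le> \<Phi> x"
    using DERIV_nonneg_imp_nondecreasing[of _ x \<Phi>] d pos
    by (intro eventually_mono[OF eventually_le_at_bot[of x]]) blast
qed simp

text \<open>
  The formal adjoint of the second-order system for \<open>u\<close>, \<open>w\<close> described at the top has unknowns
  \<open>U\<close>, \<open>Y\<close>; in terms of a dual solution \<open>X\<close> these are \<open>U = -(1 - v) X\<^sub>3 / m\<close> and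
  \<open>Y = X\<^sub>2 - X\<^sub>3 + U\<close>, and in the reflected variable
  \<open>U' = -(1 - v) (X\<^sub>1 + Y)\<close>, \<open>Y' = -m Y + U'\<close>. The energy
  \<open>\<Phi> = -Re (X\<^sub>1 conj U) - |Y|\<^sup>2 / 2\<close> is nondecreasing and starts from \<open>0\<close>, so it is nonnegative.
  If \<open>X\<^sub>1(0) = 0\<close>, then \<open>\<Phi>(0) = -|Y(0)|\<^sup>2 / 2\<close>, so \<open>Y(0) = 0\<close> and \<open>\<Phi>\<close> vanishes on the left half
  line. There \<open>X\<^sub>1 + Y = 0\<close>, whose one-sided derivative at \<open>0\<close> gives \<open>X\<^sub>3(0) = 0\<close>, hence
  \<open>X(0) = 0\<close> and \<open>X\<close> could not have a nonzero limit.
\<close>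

lemma inflow_energy:
  assumes X: "logistic_solution (inflow_limit m) inflow_coupling c (vector [0, - 1, m / (- 1 - m)]) X"
    and m: "Re m \<ge> 0" "m \<noteq> 0" and c: "c > 0"
  shows "X 0 $ 1 \<noteq> 0"
proof
  assume X10: "X 0 $ 1 = 0"
  define v where "v = (\<lambda>x. complex_of_real (logistic c x))"
  define U where "U = (\<lambda>x. - (1 - v x) * X x $ 3 / m)"
  define Y where "Y = (\<lambda>x. X x $ 2 - X x $ 3 + U x)"
  have m1: "1 + m \<noteq> 0" using m by (auto simp: complex_eq_iff)
  have dv: "(v has_vector_derivative (v x * (1 - v x))) (at x)" for x
    unfolding v_def using has_vector_derivative_of_real[OF logistic_deriv[OF c], of x] by simp
  have v1: "v x \<noteq> 1" for x using logistic_bounds(2)[OF c, of x] by (simp add: v_def)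
  have dX: "((\<lambda>x. X x $ 1) has_vector_derivative (v x * X x $ 3)) (at x)"
    "((\<lambda>x. X x $ 2) has_vector_derivative (m * X x $ 1 + v x * X x $ 3)) (at x)"
    "((\<lambda>x. X x $ 3) has_vector_derivative
       ((- 1 - m) * X x $ 3 + (m * X x $ 1 + m * X x $ 2 + v x * (2 * X x $ 3)))) (at x)" for x
    using inflow_components[OF X, of x] by (simp_all add: scaleR_conv_of_real[where 'a = complex] v_def)
  have dU: "(U has_vector_derivative (- (1 - v x) * (X x $ 1 + Y x))) (at x)" for x
  proof -
    have "(U has_vector_derivative ((- (1 - v x) * ((- 1 - m) * X x $ 3 + (m * X x $ 1 + m * X x $ 2 + v x * (2 * X x $ 3)))
      + - (0 - v x * (1 - v x)) * X x $ 3) / m)) (at x)"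
      unfolding U_def
      by (intro has_vector_derivative_divide has_vector_derivative_mult has_vector_derivative_minus
          has_vector_derivative_diff has_vector_derivative_const dv dX)
    then show ?thesis
      by (rule back_subst[of "\<lambda>D. (U has_vector_derivative D) (at x)"])
        (use m in \<open>simp add: Y_def U_def field_simps\<close>)
  qed
  have dY: "(Y has_vector_derivative (- m * Y x - (1 - v x) * (X x $ 1 + Y x))) (at x)" for x
  proof -
    have "(Y has_vector_derivative (m * X x $ 1 + v x * X x $ 3 -
        ((- 1 - m) * X x $ 3 + (m * X x $ 1 + m * X x $ 2 + v x * (2 * X x $ 3)))
        + - (1 - v x) * (X x $ 1 + Y x))) (at x)"
      unfolding Y_def[abs_def] by (intro has_vector_derivative_diff has_vector_derivative_add dX dU[unfolded Y_def])
    then show ?thesis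
      by (rule back_subst[of "\<lambda>D. (Y has_vector_derivative D) (at x)"])
        (use m in \<open>simp add: Y_def U_def field_simps\<close>)
  qed
  define \<Phi> where "\<Phi> = (\<lambda>x. Re (- (X x $ 1 * cnj (U x)) - Y x * cnj (Y x) / 2))"
  define f where "f = (\<lambda>x. logistic c x / (1 - logistic c x))"
  define \<Phi>' where "\<Phi>' = (\<lambda>x. Re m * (f x * (cmod (U x))\<^sup>2 + (cmod (Y x))\<^sup>2)
      + (1 - logistic c x) * (cmod (X x $ 1 + Y x))\<^sup>2)"
  have d\<Phi>: "(\<Phi> has_real_derivative \<Phi>' x) (at x)" for x
  proof -
    let ?e = "1 - logistic c x"
    \<comment> \<open>\<open>f = v / (1 - v)\<close> appears when \<open>X\<^sub>3\<close> is expressed through \<open>U\<close>.\<close>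
    have vX3: "v x * X x $ 3 = - (m * of_real (f x) * U x)"
      using v1[of x] m by (simp add: U_def f_def v_def field_simps)
    let ?G = "- (X x $ 1 * cnj (- (1 - v x) * (X x $ 1 + Y x)) + - (m * of_real (f x) * U x) * cnj (U x))
      - (Y x * cnj (- m * Y x - (1 - v x) * (X x $ 1 + Y x)) + (- m * Y x - (1 - v x) * (X x $ 1 + Y x)) * cnj (Y x)) / 2"
    have "((\<lambda>x. - (X x $ 1 * cnj (U x)) - Y x * cnj (Y x) / 2) has_vector_derivative ?G) (at x)"
      by (intro has_vector_derivative_diff has_vector_derivative_minus has_vector_derivative_mult
          has_vector_derivative_cnj has_vector_derivative_divide dX(1)[of x, unfolded vX3] dU dY)
    from bounded_linear.has_vector_derivative[OF bounded_linear_Re this]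
    have "(\<Phi> has_real_derivative Re ?G) (at x)"
      by (simp add: \<Phi>_def has_real_derivative_iff_has_vector_derivative)
    moreover have "Re ?G = \<Phi>' x"
      unfolding \<Phi>'_def v_def by (simp add: cmod_power2) (simp add: power2_eq_square field_simps)
    ultimately show ?thesis by simp
  qed
  have pos: "\<Phi>' x \<ge> 0" for x
    using m logistic_bounds[OF c, of x] by (simp add: \<Phi>'_def f_def)
  have limX: "((\<lambda>x. X x $ i) \<longlongrightarrow> vector [0, - 1, m / (- 1 - m)] $ i) at_bot" for i
    using X by (auto simp: logistic_solution_def intro!: tendsto_vec_nth)
  have limv: "(v \<longlongrightarrow> 0) at_bot"
    unfolding v_def using tendsto_of_real[OF logistic_tendsto_0[OF c]] by simp
  have limU: "(U \<longlongrightarrow> - (1 - 0) * (m / (- 1 - m)) / m) at_bot"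
    unfolding U_def using limX[of 3] by (intro tendsto_intros limv m) simp_all
  have limY: "(Y \<longlongrightarrow> 0) at_bot"
  proof -
    have "(Y \<longlongrightarrow> - 1 - m / (- 1 - m) + (- (1 - 0) * (m / (- 1 - m)) / m)) at_bot"
      unfolding Y_def using limX[of 2] limX[of 3] by (intro tendsto_intros limU) simp_all
    moreover have "- 1 - m / (- 1 - m) + (- (1 - 0) * (m / (- 1 - m)) / m) = 0"
    proof -
      have "m / (- 1 - m) = m / (- (1 + m))" by simp
      also have "\<dots> = - (m / (1 + m))" by (rule divide_minus_right)
      finally have e: "m / (- 1 - m) = - (m / (1 + m))" .
      have "m / (1 + m) / m = 1 / (1 + m)" using m by simp
      moreover have "m / (1 + m) + 1 / (1 + m) = 1"
        using m1 by (simp add: add_divide_distrib[symmetric] add.commute)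
      ultimately show ?thesis unfolding e by (simp add: algebra_simps)
    qed
    ultimately show ?thesis by simp
  qed
  have "(\<Phi> \<longlongrightarrow> Re (- (0 * cnj (- (1 - 0) * (m / (- 1 - m)) / m)) - 0 * cnj 0 / 2)) at_bot"
    unfolding \<Phi>_def using limX[of 1] by (intro tendsto_intros limU limY) simp_all
  then have lim\<Phi>: "(\<Phi> \<longlongrightarrow> 0) at_bot" by simp
  have ge0: "\<Phi> x \<ge> 0" for x by (rule nondecreasing_from_zero[OF d\<Phi> pos lim\<Phi>])
  have \<Phi>0: "\<Phi> 0 = - (cmod (Y 0))\<^sup>2 / 2" by (simp add: \<Phi>_def X10 cmod_power2) (simp add: power2_eq_square field_simps)
  then have Y0: "Y 0 = 0" and \<Phi>0: "\<Phi> 0 = 0" using ge0[of 0] by (auto simp: not_less)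
  \<comment> \<open>Each point of the left half line is a global minimum of \<open>\<Phi>\<close>, so the dissipation vanishes there.\<close>
  have h0: "X x $ 1 + Y x = 0" if "x \<le> 0" for x
  proof -
    have "\<Phi> x \<le> \<Phi> 0" by (rule DERIV_nonneg_imp_nondecreasing[OF that]) (use d\<Phi> pos in blast)
    then have "\<Phi> x = 0" using \<Phi>0 ge0[of x] by simp
    then have "\<Phi>' x = 0"
      using DERIV_local_min[OF d\<Phi>, of 1 x] ge0 by auto
    moreover have "f x \<ge> 0" using logistic_bounds[OF c, of x] by (simp add: f_def)
    ultimately have "(1 - logistic c x) * (cmod (X x $ 1 + Y x))\<^sup>2 = 0"
      using m logistic_bounds[OF c, of x] unfolding \<Phi>'_def
      by (smt (verit) mult_nonneg_nonneg zero_le_power2)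
    then show ?thesis using logistic_bounds(2)[OF c, of x] by simp
  qed
  have "v 0 * X 0 $ 3 = 0"
  proof -
    have "((\<lambda>x. X x $ 1 + Y x) has_vector_derivative
        (v 0 * X 0 $ 3 + (- m * Y 0 - (1 - v 0) * (X 0 $ 1 + Y 0)))) (at 0 within {- 1..0})"
      by (intro has_vector_derivative_at_within[OF has_vector_derivative_add] dX dY)
    moreover have "((\<lambda>x. X x $ 1 + Y x) has_vector_derivative 0) (at 0 within {- 1..0})"
      by (rule has_vector_derivative_transform[of _ _ _ "\<lambda>_. 0"]) (use h0 in auto)
    ultimately have "v 0 * X 0 $ 3 + (- m * Y 0 - (1 - v 0) * (X 0 $ 1 + Y 0)) = 0"
      by (intro vector_derivative_unique_within_closed_interval[of "- 1" 0 0]) auto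
    then show ?thesis using Y0 X10 by simp
  qed
  then have X30: "X 0 $ 3 = 0" using logistic_bounds(1)[OF c, of 0] by (simp add: v_def)
  then have "X 0 $ 2 = 0" using Y0 by (simp add: Y_def U_def)
  then have "X 0 = 0" using X10 X30 by (simp add: vec3_eq_iff)
  from logistic_solution_zero[OF X c this]
  show False by (simp add: vec3_eq_iff)
qed

lemma D0_in_nonzero:
  assumes "0 < v0" "v0 < 1" "Re l \<ge> 0" "l \<noteq> 0"
  shows "D0_in v0 l \<noteq> 0"
proof -
  have "D0_in v0 l = cnj (W1_in v0 l (- 0) $ 1)"
    by (simp add: D0_in_def cdot_def sum_3)
  then show ?thesis
    using inflow_energy[OF W1_in_reflected[OF assms(1-3)]] assms by simp
qed

section \<open>Outflow: the growing solution\<close>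

definition outflow_limit :: "complex \<Rightarrow> complex ^ 3 ^ 3" where
  "outflow_limit l = vector [vector [0, l, l], vector [0, 0, l], vector [1, 1, 1 - l]]"

definition outflow_coupling :: "complex ^ 3 ^ 3" where
  "outflow_coupling = vector [vector [0, 0, 0], vector [0, 0, 0], vector [1, 1, 2]]"

lemma A0_split:
  assumes "0 < v0" "v0 < 1"
  shows "A0 v0 x l *v w = outflow_limit l *v w - logistic (v0 / (1 - v0)) x *\<^sub>R (outflow_coupling *v w)"
  by (simp add: vec3_eq_iff matrix_vector_mult_3 A0_def Let_def vhat_complement[OF assms] outflow_limit_def outflow_coupling_def
      scaleR_conv_of_real[where 'a = complex])
    (simp add: algebra_simps)

lemma A0_minf_eq:
  assumes "0 < v0" "v0 < 1"
  shows "A0_minf v0 l = outflow_limit l"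
  unfolding A0_minf_def
proof (rule tendsto_Lim)
  have lim: "((\<lambda>x. complex_of_real (vhat v0 x)) \<longlongrightarrow> 1) at_bot"
  proof -
    have "((\<lambda>x. 1 - logistic (v0 / (1 - v0)) x) \<longlongrightarrow> 1 - 0) at_bot"
      using assms by (intro tendsto_intros logistic_tendsto_0) simp
    then have "((\<lambda>x. complex_of_real (1 - logistic (v0 / (1 - v0)) x)) \<longlongrightarrow> of_real (1 - 0)) at_bot"
      by (rule tendsto_of_real)
    then show ?thesis by (simp add: vhat_complement[OF assms])
  qed
  have lim3: "((\<lambda>x. 2 * complex_of_real (vhat v0 x) - 1 - l) \<longlongrightarrow> 2 * 1 - 1 - l) at_bot"
    by (intro tendsto_intros lim)
  have "((\<lambda>x. A0 v0 x l $ i $ j) \<longlongrightarrow> outflow_limit l $ i $ j) at_bot" for i j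
    using exhaust_3[of i] exhaust_3[of j] lim lim3
    by (auto simp: A0_def outflow_limit_def Let_def)
  then show "((\<lambda>x. A0 v0 x l) \<longlongrightarrow> outflow_limit l) at_bot"
    by (intro vec_tendstoI)
qed simp

text \<open>
  The characteristic polynomial at \<open>-\<infinity>\<close> factors as \<open>(m + \<lambda>) (m\<^sup>2 - m - \<lambda>)\<close>, up to sign.
  Of its roots \<open>-\<lambda>\<close>, \<open>\<mu>\<close>, \<open>1 - \<mu>\<close> only \<open>\<mu>\<close> has positive real part.
\<close>

lemma outflow_limit_eigenvalue:
  assumes w: "outflow_limit l *v w = m *s w" "w \<noteq> 0" and m: "m \<noteq> 0"
  shows "(m + l) * (m\<^sup>2 - m - l) = 0"
proof -
  have e: "l * w $ 2 + l * w $ 3 = m * w $ 1" "l * w $ 3 = m * w $ 2"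
    "w $ 1 + w $ 2 + (1 - l) * w $ 3 = m * w $ 3"
    using w by (auto simp: vec3_eq_iff matrix_vector_mult_3 outflow_limit_def)
  have "w $ 3 \<noteq> 0"
  proof
    assume "w $ 3 = 0"
    moreover from this have "w $ 2 = 0" using e(2) m by simp
    moreover from this \<open>w $ 3 = 0\<close> have "w $ 1 = 0" using e(1) m by simp
    ultimately show False using w(2) by (simp add: vec3_eq_iff)
  qed
  moreover have "(m + l) * (m\<^sup>2 - m - l) * w $ 3 = 0"
    using e by algebra
  ultimately show ?thesis by simp
qed

text \<open>
  \<open>Re \<lambda> = Re \<mu> (Re \<mu> - 1) - (Im \<mu>)\<^sup>2\<close>. The lower bound \<open>1\<close> makes the quadratic
  energy decay although its weight \<open>1 / (1 - v)\<close> grows like \<open>exp (-x)\<close> at \<open>-\<infinity>\<close>.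
\<close>

lemma Re_root_ge_1:
  assumes "\<mu>\<^sup>2 - \<mu> = l" "Re l \<ge> 0" "Re \<mu> > 0"
  shows "Re \<mu> \<ge> 1"
proof -
  have "Re l = Re \<mu> * (Re \<mu> - 1) - (Im \<mu>)\<^sup>2"
    unfolding assms(1)[symmetric] by (simp add: power2_eq_square algebra_simps)
  then have "Re \<mu> * (Re \<mu> - 1) \<ge> 0" using assms(2) zero_le_power2[of "Im \<mu>"] by linarith
  then show ?thesis using assms(3) by (simp add: zero_le_mult_iff)
qed

lemma mu_minus_char:
  assumes v0: "0 < v0" "v0 < 1" and l: "Re l \<ge> 0"
  shows "0 < Re (mu_minus v0 l)" and "(mu_minus v0 l)\<^sup>2 - mu_minus v0 l = l"
    and "\<And>m w. 0 < Re m \<Longrightarrow> w \<noteq> 0 \<Longrightarrow> outflow_limit l *v w = m *s w \<Longrightarrow> m = mu_minus v0 l"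
proof -
  define \<mu> where "\<mu> = (1 + csqrt (1 + 4 * l)) / 2"
  have \<mu>: "0 < Re \<mu>"
    using Re_csqrt[of "1 + 4 * l"] by (simp add: \<mu>_def add_pos_nonneg)
  have sq: "\<mu>\<^sup>2 - \<mu> = l"
  proof -
    have "(csqrt (1 + 4 * l))\<^sup>2 = 1 + 4 * l" by simp
    then show ?thesis unfolding \<mu>_def by (simp add: power2_eq_square field_simps)
  qed
  have uniq: "m = \<mu>" if m: "0 < Re m" "w \<noteq> 0" "outflow_limit l *v w = m *s w" for m w
  proof -
    have "m \<noteq> 0" "m + l \<noteq> 0" using m l by (auto simp: complex_eq_iff)
    then have "m\<^sup>2 - m - l = 0" using outflow_limit_eigenvalue[OF m(3,2)] by simp
    then have "(m - \<mu>) * (m + \<mu> - 1) = 0" using sq by algebra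
    moreover have "m + \<mu> - 1 \<noteq> 0"
    proof
      assume "m + \<mu> - 1 = 0"
      then have "Re m + Re \<mu> = 1" by (simp add: complex_eq_iff)
      moreover have "Re \<mu> \<ge> 1" using Re_root_ge_1[OF sq l \<mu>] .
      ultimately show False using m(1) by simp
    qed
    ultimately show ?thesis by simp
  qed
  \<comment> \<open>With third component \<open>1\<close>, the first two rows force \<open>b = l / \<mu> = \<mu> - 1\<close> and \<open>a = l (b + 1) / \<mu> = l\<close>.\<close>
  have ev: "outflow_limit l *v vector [l, \<mu> - 1, 1] = \<mu> *s vector [l, \<mu> - 1, 1]"
    unfolding vec3_eq_iff matrix_vector_mult_3 outflow_limit_def using sq by (auto simp: power2_eq_square algebra_simps)
  have nz: "vector [l, \<mu> - 1, 1] \<noteq> (0 :: complex ^ 3)" by (simp add: vec3_eq_iff)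
  have "mu_minus v0 l = \<mu>"
    unfolding mu_minus_def A0_minf_eq[OF v0]
    using \<mu> ev nz uniq by (intro the_equality) blast+
  then show "0 < Re (mu_minus v0 l)" "(mu_minus v0 l)\<^sup>2 - mu_minus v0 l = l"
    and "\<And>m w. 0 < Re m \<Longrightarrow> w \<noteq> 0 \<Longrightarrow> outflow_limit l *v w = m *s w \<Longrightarrow> m = mu_minus v0 l"
    using \<mu> sq uniq by auto
qed

lemma outflow_components:
  assumes "logistic_solution (outflow_limit l - mat \<mu>) outflow_coupling c V X"
  shows "((\<lambda>x. X x $ 1) has_vector_derivative (l * (X x $ 2 + X x $ 3) - \<mu> * X x $ 1)) (at x)"
    and "((\<lambda>x. X x $ 2) has_vector_derivative (l * X x $ 3 - \<mu> * X x $ 2)) (at x)"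
    and "((\<lambda>x. X x $ 3) has_vector_derivative
       (X x $ 1 + X x $ 2 + (1 - l - \<mu>) * X x $ 3
          - of_real (logistic c x) * (X x $ 1 + X x $ 2 + 2 * X x $ 3))) (at x)"
proof -
  have d: "(X has_vector_derivative ((outflow_limit l - mat \<mu>) *v X x - logistic c x *\<^sub>R (outflow_coupling *v X x))) (at x)"
    using assms by (simp add: logistic_solution_def)
  note e = has_vector_derivative_vec_nth[OF d, unfolded shifted_matrix_mult]
  show "((\<lambda>x. X x $ 1) has_vector_derivative (l * (X x $ 2 + X x $ 3) - \<mu> * X x $ 1)) (at x)"
    using e[of 1] by (simp add: matrix_vector_mult_3 outflow_limit_def outflow_coupling_def algebra_simps)
  show "((\<lambda>x. X x $ 2) has_vector_derivative (l * X x $ 3 - \<mu> * X x $ 2)) (at x)"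
    using e[of 2] by (simp add: matrix_vector_mult_3 outflow_limit_def outflow_coupling_def)
  show "((\<lambda>x. X x $ 3) has_vector_derivative
       (X x $ 1 + X x $ 2 + (1 - l - \<mu>) * X x $ 3
          - of_real (logistic c x) * (X x $ 1 + X x $ 2 + 2 * X x $ 3))) (at x)"
    using e[of 3] by (simp add: matrix_vector_mult_3 outflow_limit_def outflow_coupling_def scaleR_conv_of_real[where 'a = complex] algebra_simps)
qed

text \<open>
  For \<open>t = 0\<close> the combinations \<open>p\<close> and \<open>q\<close> are left eigenvectors of the shifted limit matrix with
  eigenvalues \<open>0\<close> and \<open>1 - 2 \<mu>\<close>, while \<open>s\<close> satisfies \<open>s' = -(l + \<mu>) s + l a\<close>
  with \<open>a = (p - q) / (2 \<mu> - 1)\<close>. In these coordinates the system is triangular, with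
  diagonal entries of nonpositive real part.
\<close>

lemma outflow_unique:
  assumes X: "logistic_solution (outflow_limit l - mat \<mu>) outflow_coupling c 0 X"
    and \<mu>: "\<mu>\<^sup>2 - \<mu> = l" "Re \<mu> \<ge> 1" and l: "Re l \<ge> 0" "l \<noteq> 0" and c: "c > 0"
  shows "X x = 0"
proof -
  define \<nu> where "\<nu> = 2 * \<mu> - 1"
  have \<nu>: "\<nu> \<noteq> 0" using \<mu>(2) by (auto simp: \<nu>_def complex_eq_iff)
  define p where "p = (\<lambda>x. l * (X x $ 2 + X x $ 3) - (1 - \<mu>) * X x $ 1)"
  define q where "q = (\<lambda>x. l * (X x $ 2 + X x $ 3) - \<mu> * X x $ 1)"
  define s where "s = (\<lambda>x. X x $ 1 - X x $ 2)"
  define g where "g = (\<lambda>x. - (l * s x + 2 * q x + 2 * \<mu> * ((p x - q x) / \<nu>)))"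
  have a: "X x $ 1 = (p x - q x) / \<nu>" for x
    using \<nu> by (simp add: p_def q_def \<nu>_def field_simps)
  have g: "g x = - (l * (X x $ 1 + X x $ 2 + 2 * X x $ 3))" for x
    unfolding g_def a[symmetric] by (simp add: s_def q_def algebra_simps)
  note d = outflow_components[OF X]
  have ls: "l = \<mu> * \<mu> - \<mu>" using \<mu>(1) by (simp add: power2_eq_square)
  have dp: "(p has_vector_derivative (0 * p x + logistic c x *\<^sub>R g x)) (at x)" for x
  proof -
    have "(p has_vector_derivative (l * ((l * X x $ 3 - \<mu> * X x $ 2) + (X x $ 1 + X x $ 2 + (1 - l - \<mu>) * X x $ 3
          - of_real (logistic c x) * (X x $ 1 + X x $ 2 + 2 * X x $ 3)))
         - (1 - \<mu>) * (l * (X x $ 2 + X x $ 3) - \<mu> * X x $ 1))) (at x)"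
      unfolding p_def
      by (intro has_vector_derivative_diff has_vector_derivative_mult_right has_vector_derivative_add d)
    then show ?thesis
      by (rule back_subst[of "\<lambda>D. (p has_vector_derivative D) (at x)"])
        (simp add: g scaleR_conv_of_real[where 'a = complex] ls algebra_simps)
  qed
  have dq: "(q has_vector_derivative ((1 - 2 * \<mu>) * q x + (0 * p x + logistic c x *\<^sub>R g x))) (at x)" for x
  proof -
    have "(q has_vector_derivative (l * ((l * X x $ 3 - \<mu> * X x $ 2) + (X x $ 1 + X x $ 2 + (1 - l - \<mu>) * X x $ 3
          - of_real (logistic c x) * (X x $ 1 + X x $ 2 + 2 * X x $ 3)))
         - \<mu> * (l * (X x $ 2 + X x $ 3) - \<mu> * X x $ 1))) (at x)"
      unfolding q_def
      by (intro has_vector_derivative_diff has_vector_derivative_mult_right has_vector_derivative_add d)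
    then show ?thesis
      by (rule back_subst[of "\<lambda>D. (q has_vector_derivative D) (at x)"])
        (simp add: g q_def scaleR_conv_of_real[where 'a = complex] ls algebra_simps)
  qed
  have ds: "(s has_vector_derivative ((- l - \<mu>) * s x + (l / \<nu> * p x + (- l / \<nu>) * q x + logistic c x *\<^sub>R 0))) (at x)" for x
  proof -
    have "(s has_vector_derivative (l * (X x $ 2 + X x $ 3) - \<mu> * X x $ 1 - (l * X x $ 3 - \<mu> * X x $ 2))) (at x)"
      unfolding s_def by (intro has_vector_derivative_diff d)
    moreover have "l / \<nu> * p x + (- l / \<nu>) * q x = l * X x $ 1"
      unfolding a by (simp add: diff_divide_distrib right_diff_distrib)
    ultimately show ?thesis by (simp add: s_def algebra_simps)
  qed
  define K where "K = cmod l + 2 + 2 * cmod \<mu> / cmod \<nu>"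
  have gb: "cmod (g x) \<le> K * (cmod (p x) + cmod (q x) + cmod (s x))" for x
  proof -
    have "cmod (g x) \<le> cmod l * cmod (s x) + 2 * cmod (q x) + 2 * cmod \<mu> * ((cmod (p x) + cmod (q x)) / cmod \<nu>)"
      unfolding g_def norm_minus_cancel
      by (intro norm_triangle_mono) (auto simp: norm_mult norm_divide intro!: mult_left_mono divide_right_mono norm_triangle_ineq4)
    also have "\<dots> = cmod l * cmod (s x) + 2 * cmod (q x) + (2 * cmod \<mu> / cmod \<nu>) * (cmod (p x) + cmod (q x))"
      by simp
    also have "\<dots> \<le> K * (cmod (p x) + cmod (q x) + cmod (s x))"
    proof -
      have "0 \<le> cmod l * (cmod (p x) + cmod (q x)) + 2 * (cmod (p x) + cmod (s x)) + (2 * cmod \<mu> / cmod \<nu>) * cmod (s x)"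
        by (intro add_nonneg_nonneg mult_nonneg_nonneg) auto
      then show ?thesis unfolding K_def by (simp add: distrib_left distrib_right)
    qed
    finally show ?thesis .
  qed
  have limX: "((\<lambda>x. X x $ i) \<longlongrightarrow> 0) at_bot" for i
    using X tendsto_vec_nth[of X 0 at_bot i] by (simp add: logistic_solution_def)
  have "(p \<longlongrightarrow> l * (0 + 0) - (1 - \<mu>) * 0) at_bot" "(q \<longlongrightarrow> l * (0 + 0) - \<mu> * 0) at_bot" "(s \<longlongrightarrow> 0 - 0) at_bot"
    unfolding p_def q_def s_def by (intro tendsto_intros limX)+
  then have lim: "(p \<longlongrightarrow> 0) at_bot" "(q \<longlongrightarrow> 0) at_bot" "(s \<longlongrightarrow> 0) at_bot" by simp_all
  have K0: "K \<ge> 0" by (simp add: K_def)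
  have "p x = 0 \<and> q x = 0 \<and> s x = 0"
  proof (rule triangular_system_unique[OF dp dq ds _ _ _ gb gb _ _ _ logistic_le_exp[OF c] lim])
    show "cmod 0 \<le> K * (cmod (p x) + cmod (q x) + cmod (s x))" for x
      using K0 by simp
  qed (use \<mu> l logistic_bounds[OF c] in \<open>auto intro: less_imp_le\<close>)
  then have z: "p x = 0" "q x = 0" "s x = 0" by auto
  have z1: "X x $ 1 = 0" unfolding a z by simp
  moreover have "X x $ 2 = 0" using z(3) z1 by (simp add: s_def)
  moreover have "X x $ 3 = 0" using z(2) z1 \<open>X x $ 2 = 0\<close> l by (simp add: q_def)
  ultimately show ?thesis by (simp add: vec3_eq_iff)
qed

text \<open>
  An eigenvalue \<open>n \<ge> 1\<close> of \<open>outflow_limit l - \<mu>\<close> would make \<open>\<mu> + n\<close> a second eigenvalue of positive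
  real part, so the recursion for the power series is never resonant.
\<close>

lemma W1_out_char:
  assumes v0: "0 < v0" "v0 < 1" and l: "Re l \<ge> 0" "l \<noteq> 0"
    and V: "A0_minf v0 l *v V l = mu_minus v0 l *s V l"
  shows "solves_linear (\<lambda>x. A0 v0 x l) (W1_out v0 V l)"
    and "logistic_solution (outflow_limit l - mat (mu_minus v0 l)) outflow_coupling (v0 / (1 - v0)) (V l)
       (\<lambda>x. exp (- mu_minus v0 l * of_real x) *s W1_out v0 V l x)"
proof -
  define c where "c = v0 / (1 - v0)"
  have c: "c > 0" using v0 by (simp add: c_def)
  define \<mu> where "\<mu> = mu_minus v0 l"
  note mu = mu_minus_char[OF v0 l(1), folded \<mu>_def]
  let ?ls = "logistic_solution (outflow_limit l - mat \<mu>) outflow_coupling c (V l)"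
  let ?e = "\<lambda>W x. exp (- \<mu> * complex_of_real x) *s W x :: complex ^ 3"
  let ?char = "\<lambda>W. solves_linear (\<lambda>x. A0 v0 x l) W \<and> (?e W \<longlongrightarrow> V l) at_bot"
  have to: "?ls (?e W)" if "?char W" for W
    unfolding logistic_solution_def
  proof (intro conjI allI)
    fix x
    have "(W has_vector_derivative (A0 v0 x l *v W x)) (at x)"
      using that by (simp add: solves_linear_def)
    from has_vector_derivative_exp_smult[OF this, of "- \<mu>"]
    show "(?e W has_vector_derivative
       ((outflow_limit l - mat \<mu>) *v ?e W x - logistic c x *\<^sub>R (outflow_coupling *v ?e W x))) (at x)"
      by (rule back_subst[of "\<lambda>D. (?e W has_vector_derivative D) (at x)"])
        (simp add: A0_split[OF v0] c_def shifted_matrix_mult scalar_matrix_mult vector_scalar_commute vec_eq_iff scaleR_conv_of_real[where 'a = complex] algebra_simps)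
  qed (use that in simp)
  have "(outflow_limit l - mat \<mu>) *v V l = 0"
    using V by (simp add: shifted_matrix_mult A0_minf_eq[OF v0] \<mu>_def)
  moreover have "w = 0" if n: "n \<ge> 1" and w: "(outflow_limit l - mat \<mu>) *v w = of_nat n *s w" for n and w :: "complex ^ 3"
  proof (rule ccontr)
    assume "w \<noteq> 0"
    moreover have "outflow_limit l *v w = (\<mu> + of_nat n) *s w"
      using w by (simp add: shifted_matrix_mult scalar_matrix_mult vector_sadd_rdistrib algebra_simps)
    ultimately have "\<mu> + of_nat n = \<mu>" using mu(1) by (intro mu(3)) auto
    then show False using n by simp
  qed
  ultimately obtain X where X: "?ls X"
    using logistic_ode_exists[OF _ _ c] by metis
  define W where "W = (\<lambda>x. exp (\<mu> * complex_of_real x) *s X x)"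
  have eW: "?e W = X" by (simp add: W_def fun_eq_iff vector_smult_assoc exp_add[symmetric])
  have cW: "?char W"
  proof
    show "(?e W \<longlongrightarrow> V l) at_bot" using X unfolding eW by (simp add: logistic_solution_def)
    show "solves_linear (\<lambda>x. A0 v0 x l) W"
      unfolding solves_linear_def
    proof
      fix x
      have "(X has_vector_derivative ((outflow_limit l - mat \<mu>) *v X x - logistic c x *\<^sub>R (outflow_coupling *v X x))) (at x)"
        using X by (simp add: logistic_solution_def)
      from has_vector_derivative_exp_smult[OF this, of \<mu>]
      show "(W has_vector_derivative (A0 v0 x l *v W x)) (at x)"
        unfolding W_def
        by (rule back_subst[of "\<lambda>D. ((\<lambda>x. exp (\<mu> * complex_of_real x) *s X x) has_vector_derivative D) (at x)"])
          (simp add: A0_split[OF v0] c_def shifted_matrix_mult scalar_matrix_mult vector_scalar_commute vec_eq_iff scaleR_conv_of_real[where 'a = complex] algebra_simps)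
    qed
  qed
  have "W1_out v0 V l = W"
    unfolding W1_out_def \<mu>_def[symmetric]
  proof (rule the_equality)
    show "?char W" by (rule cW)
    fix W' assume "?char W'"
    from logistic_solution_diff[OF to[OF this] X]
    have z: "?e W' x - X x = 0" for x
      using outflow_unique[of l \<mu> c "\<lambda>x. ?e W' x - X x" x] mu(2) Re_root_ge_1[OF mu(2) l(1) mu(1)] l c by simp
    show "W' = W"
    proof
      fix x
      have "exp (\<mu> * complex_of_real x) *s ?e W' x = W x" using z[of x] by (simp add: W_def)
      then show "W' x = W x" by (simp add: vector_smult_assoc exp_add[symmetric])
    qed
  qed
  then show "solves_linear (\<lambda>x. A0 v0 x l) (W1_out v0 V l)"
    "logistic_solution (outflow_limit l - mat (mu_minus v0 l)) outflow_coupling (v0 / (1 - v0)) (V l)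
       (\<lambda>x. exp (- mu_minus v0 l * of_real x) *s W1_out v0 V l x)"
    using cW to[OF cW] by (simp_all add: c_def \<mu>_def)
qed

section \<open>Outflow: the energy estimate and the threshold\<close>

text \<open>
  \<open>v_star\<close> is the unique zero in \<open>(0, 1)\<close> of the increasing function \<open>ln v + 2 / (1 - v)\<^sup>2\<close>, which
  is nonpositive at \<open>exp (-8)\<close> and positive at \<open>1/2\<close>.
\<close>

lemma v_star_bound:
  assumes "v_star < v0" "v0 < 1"
  shows "0 < v0" and "- ln v0 < 2 / (1 - v0)\<^sup>2"
proof -
  define g where "g = (\<lambda>v::real. ln v + 2 / (1 - v)\<^sup>2)"
  have mono: "g x < g y" if "0 < x" "x < y" "y < 1" for x y
  proof -
    have "(1 - y)\<^sup>2 < (1 - x)\<^sup>2" using that by (intro power_strict_mono) auto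
    then have "2 / (1 - x)\<^sup>2 < 2 / (1 - y)\<^sup>2" using that by (intro divide_strict_left_mono) auto
    then show ?thesis using that by (simp add: g_def add_strict_mono)
  qed
  have iff: "v = exp (- 2 / (1 - v)\<^sup>2) \<longleftrightarrow> g v = 0" if "0 < v" for v
  proof -
    have "v = exp y \<longleftrightarrow> ln v = y" for y using that by auto
    from this[of "- 2 / (1 - v)\<^sup>2"] show ?thesis by (auto simp: g_def)
  qed
  have e8: "exp (- 8) \<le> (1 / 2 :: real)"
    using exp_ge_add_one_self[of "8::real"] by (simp add: exp_minus field_simps)
  have "\<exists>v\<ge>exp (- 8). v \<le> 1 / 2 \<and> g v = 0"
  proof (rule IVT')
    have "(1 / 2)\<^sup>2 \<le> (1 - exp (- 8) :: real)\<^sup>2" using e8 by (intro power_mono) auto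
    then have "2 / (1 - exp (- 8) :: real)\<^sup>2 \<le> 2 / (1 / 2)\<^sup>2"
      by (intro divide_left_mono) (auto simp: zero_less_mult_iff)
    then show "g (exp (- 8)) \<le> 0" by (simp add: g_def power2_eq_square)
    have "ln (1 / 2 :: real) \<ge> - 1" using ln_add_one_self_le_self[of "1::real"] by (simp add: ln_div)
    then show "0 \<le> g (1 / 2)" by (simp add: g_def power2_eq_square)
    show "continuous_on {exp (- 8)..1 / 2} g"
      unfolding g_def by (intro continuous_intros) (auto dest: less_le_trans[OF exp_gt_zero])
  qed (rule e8)
  then obtain v where v8: "exp (- 8) \<le> v" "v \<le> 1 / 2" "g v = 0" by blast
  have v: "0 < v" "v < 1" using v8 less_le_trans[OF exp_gt_zero v8(1)] by auto
  have "v_star = v"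
    unfolding v_star_def
  proof (rule the_equality)
    show "0 < v \<and> v < 1 \<and> v = exp (- 2 / (1 - v)\<^sup>2)" using v iff v8(3) by blast
    fix u :: real assume u: "0 < u \<and> u < 1 \<and> u = exp (- 2 / (1 - u)\<^sup>2)"
    then have "g u = 0" using iff by blast
    then show "u = v" using mono[of u v] mono[of v u] u v v8(3) by (cases u v rule: linorder_cases) auto
  qed
  then show v0: "0 < v0" using assms v by simp
  show "- ln v0 < 2 / (1 - v0)\<^sup>2"
    using mono[of v v0] assms v v8(3) \<open>v_star = v\<close> by (simp add: g_def)
qed

text \<open>
  Derivative of the energy below, with \<open>a = u\<close>, \<open>d = u'\<close>, \<open>b = w\<close>, \<open>e = w' = d - l b\<close>,
  \<open>k = 1 / t\<close>, and \<open>\<sigma> = 1 / \<tau>\<close>. Completing the square in \<open>d\<close> uses that the derivative of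
  \<open>\<tau>\<close> is \<open>t = 1 / k\<close>.
\<close>

lemma outflow_energy_identity:
  fixes l a b e :: complex and f k t \<sigma> :: real
  assumes "k * t = 1"
  defines "d \<equiv> l * b + e"
  shows "Re ((of_real k * d) * cnj d + (l * (of_real f * a) - e) * cnj a
      + (b * cnj d + e * cnj a) - (b * cnj e + e * cnj b) / 2
      - (a * cnj a * of_real (- t * \<sigma>\<^sup>2) + (a * cnj d + d * cnj a) * of_real \<sigma>))
    = Re l * (f * (cmod a)\<^sup>2 + (cmod b)\<^sup>2) + k * (cmod (d - of_real (t * \<sigma>) * a))\<^sup>2"
proof -
  have *: "k * (cmod (d - of_real (t * \<sigma>) * a))\<^sup>2
     = k * (cmod d)\<^sup>2 - 2 * \<sigma> * Re (a * cnj d) + t * \<sigma>\<^sup>2 * (cmod a)\<^sup>2"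
  proof -
    have "(cmod (d - of_real (t * \<sigma>) * a))\<^sup>2
      = (cmod d)\<^sup>2 - 2 * (t * \<sigma>) * Re (a * cnj d) + (t * \<sigma>)\<^sup>2 * (cmod a)\<^sup>2"
      unfolding cmod_power2 by (simp add: power2_eq_square algebra_simps)
    then have "k * (cmod (d - of_real (t * \<sigma>) * a))\<^sup>2
      = k * ((cmod d)\<^sup>2 - 2 * (t * \<sigma>) * Re (a * cnj d) + (t * \<sigma>)\<^sup>2 * (cmod a)\<^sup>2)"
      by simp
    also have "\<dots> = k * (cmod d)\<^sup>2 - 2 * ((k * t) * \<sigma>) * Re (a * cnj d) + (k * t) * (t * \<sigma>\<^sup>2) * (cmod a)\<^sup>2"
      by (simp add: power2_eq_square algebra_simps)
    finally show ?thesis unfolding assms(1) by simp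
  qed
  have "Re ((of_real k * d) * cnj d) = k * (cmod d)\<^sup>2"
    unfolding cmod_power2 by (simp add: power2_eq_square algebra_simps)
  moreover have "Re ((l * (of_real f * a) - e) * cnj a + (b * cnj d + e * cnj a) - (b * cnj e + e * cnj b) / 2)
     = Re l * (f * (cmod a)\<^sup>2 + (cmod b)\<^sup>2)"
    unfolding cmod_power2 d_def by (simp add: power2_eq_square algebra_simps)
  moreover have "Re (a * cnj a * of_real (- t * \<sigma>\<^sup>2) + (a * cnj d + d * cnj a) * of_real \<sigma>)
     = 2 * \<sigma> * Re (a * cnj d) - t * \<sigma>\<^sup>2 * (cmod a)\<^sup>2"
    unfolding cmod_power2 by (simp add: power2_eq_square algebra_simps)
  ultimately show ?thesis unfolding * by simp
qed

text \<open>
  Put \<open>t = 1 - v\<close> and \<open>\<tau> = -ln v\<close>, which is the integral of \<open>1 - v\<close> over \<open>(-\<infinity>, x)\<close>. Subtracting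
  \<open>|u|\<^sup>2 / \<tau>\<close> from the basic energy \<open>Re (u' conj u) / t + Re (w conj u) - |w|\<^sup>2 / 2\<close> replaces the
  dissipation \<open>|u'|\<^sup>2 / t\<close> by \<open>|u' - t u / \<tau>|\<^sup>2 / t\<close>, still nonnegative: this is the Cauchy-Schwarz bound
  \<open>|u(x)|\<^sup>2 \<le> \<tau>(x) \<integral> |u'|\<^sup>2 / t\<close> in differential form. The conclusion is that the modified
  energy, which tends to \<open>0\<close> at \<open>-\<infinity>\<close>, is nonnegative at \<open>x = 0\<close>.
\<close>

lemma outflow_energy:
  assumes W: "solves_linear (\<lambda>x. A0 v0 x l) W" and v0: "0 < v0" "v0 < 1"
    and X: "logistic_solution (outflow_limit l - mat \<mu>) outflow_coupling (v0 / (1 - v0)) V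
       (\<lambda>x. exp (- \<mu> * of_real x) *s W x)"
    and \<mu>: "Re \<mu> \<ge> 1" and l: "Re l \<ge> 0"
  shows "Re (W 0 $ 1 * cnj (l * (W 0 $ 2 + W 0 $ 3))) / (1 - v0) + Re (W 0 $ 2 * cnj (W 0 $ 1))
       - (cmod (W 0 $ 2))\<^sup>2 / 2 + (cmod (W 0 $ 1))\<^sup>2 / ln v0 \<ge> 0"
proof -
  define c where "c = v0 / (1 - v0)"
  have c: "c > 0" using v0 by (simp add: c_def)
  define t where "t = logistic c"
  have t: "0 < t x" "t x < 1" for x using logistic_bounds[OF c] by (auto simp: t_def)
  have dt: "(t has_real_derivative t x * (1 - t x)) (at x)" for x
    unfolding t_def by (rule logistic_deriv[OF c])
  define \<tau> where "\<tau> = (\<lambda>x. - ln (1 - t x))"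
  define a b c3 where "a = (\<lambda>x. W x $ 1)" and "b = (\<lambda>x. W x $ 2)" and "c3 = (\<lambda>x. W x $ 3)"
  define e where "e = (\<lambda>x. l * c3 x)"
  define d where "d = (\<lambda>x. l * b x + e x)"
  have dW: "(W has_vector_derivative (outflow_limit l *v W x - t x *\<^sub>R (outflow_coupling *v W x))) (at x)" for x
    using W by (simp add: solves_linear_def A0_split[OF v0] t_def c_def)
  note dWi = has_vector_derivative_vec_nth[OF dW]
  have da: "(a has_vector_derivative d x) (at x)" for x
    using dWi[of 1 x] by (simp add: a_def b_def c3_def d_def e_def matrix_vector_mult_3 outflow_limit_def outflow_coupling_def distrib_left)
  have db: "(b has_vector_derivative e x) (at x)" for x
    using dWi[of 2 x] by (simp add: b_def c3_def e_def matrix_vector_mult_3 outflow_limit_def outflow_coupling_def)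
  have dc: "(c3 has_vector_derivative (a x + b x + (1 - l) * c3 x - of_real (t x) * (a x + b x + 2 * c3 x))) (at x)" for x
    using dWi[of 3 x] by (simp add: a_def b_def c3_def matrix_vector_mult_3 outflow_limit_def outflow_coupling_def scaleR_conv_of_real[where 'a = complex])
  have \<tau>t: "t x \<le> \<tau> x" for x
    using ln_le_minus_one[of "1 - t x"] t[of x] by (simp add: \<tau>_def)
  have \<tau>0: "\<tau> x > 0" for x using \<tau>t[of x] t[of x] by linarith
  have d\<tau>: "(\<tau> has_real_derivative t x) (at x)" for x
    unfolding \<tau>_def using t[of x]
    by (auto intro!: derivative_eq_intros dt simp: divide_simps)
  define \<sigma> where "\<sigma> = (\<lambda>x. 1 / \<tau> x)"
  have d\<sigma>: "(\<sigma> has_real_derivative (- t x * (\<sigma> x)\<^sup>2)) (at x)" for x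
    unfolding \<sigma>_def using \<tau>0[of x]
    by (auto intro!: derivative_eq_intros d\<tau> simp: power2_eq_square)
  define k where "k = (\<lambda>x. 1 / t x)"
  define f where "f = (\<lambda>x. (1 - t x) / t x)"
  have kt: "k x * t x = 1" for x using t(1)[of x] by (simp add: k_def)
  have dk: "(k has_real_derivative (- f x)) (at x)" for x
    unfolding k_def f_def using t(1)[of x]
    by (auto intro!: derivative_eq_intros dt simp: power2_eq_square divide_simps)
  define KD where "KD = (\<lambda>x. of_real (k x) * d x)"
  have dKD: "(KD has_vector_derivative (l * (of_real (f x) * a x) - e x)) (at x)" for x
  proof -
    have "(KD has_vector_derivative (of_real (k x) * (l * e x + l * (a x + b x + (1 - l) * c3 x
         - of_real (t x) * (a x + b x + 2 * c3 x))) + of_real (- f x) * d x)) (at x)"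
      unfolding KD_def d_def e_def
      by (intro has_vector_derivative_mult has_vector_derivative_of_real dk has_vector_derivative_add
          has_vector_derivative_mult_right db[unfolded e_def] dc)
    moreover have "of_real (k x) * (l * e x + l * (a x + b x + (1 - l) * c3 x
         - of_real (t x) * (a x + b x + 2 * c3 x))) + of_real (- f x) * d x = l * (of_real (f x) * a x) - e x"
      using t(1)[of x] by (simp add: k_def f_def d_def e_def field_simps)
    ultimately show ?thesis by simp
  qed
  define \<Psi> where "\<Psi> = (\<lambda>x. Re (KD x * cnj (a x) + b x * cnj (a x) - b x * cnj (b x) / 2
      - a x * cnj (a x) * of_real (\<sigma> x)))"
  define \<Psi>' where "\<Psi>' = (\<lambda>x. Re l * (f x * (cmod (a x))\<^sup>2 + (cmod (b x))\<^sup>2)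
      + k x * (cmod (d x - of_real (t x * \<sigma> x) * a x))\<^sup>2)"
  have d\<Psi>: "(\<Psi> has_real_derivative \<Psi>' x) (at x)" for x
  proof -
    have "((\<lambda>x. KD x * cnj (a x) + b x * cnj (a x) - b x * cnj (b x) / 2
      - a x * cnj (a x) * of_real (\<sigma> x)) has_vector_derivative
      (KD x * cnj (d x) + (l * (of_real (f x) * a x) - e x) * cnj (a x)
      + (b x * cnj (d x) + e x * cnj (a x)) - (b x * cnj (e x) + e x * cnj (b x)) / 2
      - (a x * cnj (a x) * of_real (- t x * (\<sigma> x)\<^sup>2) + (a x * cnj (d x) + d x * cnj (a x)) * of_real (\<sigma> x)))) (at x)"
      by (intro has_vector_derivative_diff has_vector_derivative_add has_vector_derivative_mult
          has_vector_derivative_cnj has_vector_derivative_divide has_vector_derivative_of_real dKD da db d\<sigma>)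
    from bounded_linear.has_vector_derivative[OF bounded_linear_Re this]
    show ?thesis
      unfolding \<Psi>_def \<Psi>'_def has_real_derivative_iff_has_vector_derivative KD_def d_def
        outflow_energy_identity[OF kt] .
  qed
  have pos: "\<Psi>' x \<ge> 0" for x
    using l t[of x] by (simp add: \<Psi>'_def f_def k_def)
  define Y where "Y = (\<lambda>x. exp (- \<mu> * of_real x) *s W x)"
  \<comment> \<open>The energy is quadratic in \<open>W\<close>, hence in modulus at most \<open>exp (2 x) M(x) / t(x)\<close> for \<open>x \<le> 0\<close>, and \<open>exp x / t = exp x + c\<close>.\<close>
  define M where "M = (\<lambda>x. cmod l * (cmod (Y x $ 2) + cmod (Y x $ 3)) * cmod (Y x $ 1) + cmod (Y x $ 2) * cmod (Y x $ 1)
      + (cmod (Y x $ 2))\<^sup>2 + (cmod (Y x $ 1))\<^sup>2)"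
  have lim\<Psi>: "(\<Psi> \<longlongrightarrow> 0) at_bot"
  proof (rule Lim_null_comparison)
    have limY: "(Y \<longlongrightarrow> V) at_bot"
      using X unfolding logistic_solution_def Y_def by blast
    have "(M \<longlongrightarrow> cmod l * (cmod (V $ 2) + cmod (V $ 3)) * cmod (V $ 1) + cmod (V $ 2) * cmod (V $ 1)
      + (cmod (V $ 2))\<^sup>2 + (cmod (V $ 1))\<^sup>2) at_bot" (is "(M \<longlongrightarrow> ?M) at_bot")
      unfolding M_def by (intro tendsto_intros limY)
    then have "((\<lambda>x. exp x * (exp x + c) * M x) \<longlongrightarrow> 0 * (0 + c) * ?M) at_bot"
      by (intro tendsto_intros exp_at_bot)
    then show "((\<lambda>x. exp x * (exp x + c) * M x) \<longlongrightarrow> 0) at_bot" by simp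
    show "\<forall>\<^sub>F x in at_bot. norm (\<Psi> x) \<le> exp x * (exp x + c) * M x"
    proof (rule eventually_mono[OF eventually_le_at_bot[of 0]])
      fix x :: real assume x: "x \<le> 0"
      have k1: "k x \<ge> 1" "\<sigma> x \<le> k x" "\<sigma> x \<ge> 0"
        using t[of x] \<tau>t[of x] \<tau>0[of x] by (auto simp: k_def \<sigma>_def intro!: divide_left_mono)
      have Wb: "cmod (W x $ i) \<le> exp x * cmod (Y x $ i)" for i
      proof -
        have "W x $ i = exp (\<mu> * of_real x) * Y x $ i"
          by (simp add: Y_def exp_minus)
        then have "cmod (W x $ i) = exp (Re \<mu> * x) * cmod (Y x $ i)" by (simp add: norm_mult)
        moreover have "exp (Re \<mu> * x) \<le> exp x"
          using \<mu> x mult_right_mono_neg[of 1 "Re \<mu>" x] by simp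
        ultimately show ?thesis by (simp add: mult_right_mono)
      qed
      have d: "cmod (d x) \<le> cmod l * (cmod (b x) + cmod (c3 x))"
        unfolding d_def e_def distrib_left norm_mult[symmetric] by (rule norm_triangle_ineq)
      have "norm (\<Psi> x) \<le> cmod (KD x * cnj (a x) + b x * cnj (a x) - b x * cnj (b x) / 2
          - a x * cnj (a x) * of_real (\<sigma> x))"
        unfolding \<Psi>_def real_norm_def by (rule abs_Re_le_cmod)
      also have "\<dots> \<le> k x * cmod (d x) * cmod (a x) + cmod (b x) * cmod (a x) + cmod (b x) * cmod (b x) / 2
          + cmod (a x) * cmod (a x) * \<sigma> x"
        using k1 by (intro order_trans[OF norm_triangle_ineq4] add_mono order_trans[OF norm_triangle_ineq])
          (auto simp: KD_def norm_mult norm_divide)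
      also have "\<dots> \<le> k x * (cmod (d x) * cmod (a x)) + k x * (cmod (b x) * cmod (a x)) + k x * (cmod (b x))\<^sup>2
          + k x * (cmod (a x))\<^sup>2"
      proof (intro add_mono)
        show "cmod (b x) * cmod (a x) \<le> k x * (cmod (b x) * cmod (a x))"
          using mult_right_mono[OF k1(1), of "cmod (b x) * cmod (a x)"] by simp
        have "cmod (b x) * cmod (b x) / 2 \<le> 1 * (cmod (b x))\<^sup>2" by (simp add: power2_eq_square)
        also have "\<dots> \<le> k x * (cmod (b x))\<^sup>2" by (rule mult_right_mono[OF k1(1)]) simp
        finally show "cmod (b x) * cmod (b x) / 2 \<le> k x * (cmod (b x))\<^sup>2" .
        show "cmod (a x) * cmod (a x) * \<sigma> x \<le> k x * (cmod (a x))\<^sup>2"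
          using mult_left_mono[OF k1(2), of "cmod (a x) * cmod (a x)"] by (simp add: power2_eq_square mult_ac)
      qed (simp add: mult_ac)
      also have "\<dots> = k x * (cmod (d x) * cmod (a x) + cmod (b x) * cmod (a x) + (cmod (b x))\<^sup>2 + (cmod (a x))\<^sup>2)"
        by (simp add: algebra_simps)
      also have "\<dots> \<le> k x * ((cmod l * (exp x * cmod (Y x $ 2) + exp x * cmod (Y x $ 3))) * (exp x * cmod (Y x $ 1))
          + (exp x * cmod (Y x $ 2)) * (exp x * cmod (Y x $ 1)) + (exp x * cmod (Y x $ 2))\<^sup>2 + (exp x * cmod (Y x $ 1))\<^sup>2)"
        using k1 Wb
        by (intro mult_left_mono add_mono mult_mono power_mono order_trans[OF d])
          (auto simp: a_def b_def c3_def)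
      also have "\<dots> = (k x * exp x * exp x) * M x"
        by (simp add: M_def power2_eq_square algebra_simps)
      also have "k x * exp x * exp x = exp x * (exp x + c)"
        using c by (simp add: k_def t_def logistic_def exp_minus field_simps)
      finally show "norm (\<Psi> x) \<le> exp x * (exp x + c) * M x" .
    qed
  qed
  have "\<Psi> 0 \<ge> 0" by (rule nondecreasing_from_zero[OF d\<Psi> pos lim\<Psi>])
  moreover have t0: "t 0 = 1 - v0" using v0 by (simp add: t_def logistic_def c_def field_simps)
  have "\<Psi> 0 = Re (a 0 * cnj (d 0)) / (1 - v0) + Re (b 0 * cnj (a 0)) - (cmod (b 0))\<^sup>2 / 2 + (cmod (a 0))\<^sup>2 / ln v0"
    unfolding \<Psi>_def KD_def k_def \<sigma>_def \<tau>_def t0 cmod_power2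
    by (simp add: power2_eq_square algebra_simps add_divide_distrib)
  ultimately show ?thesis
    by (simp add: a_def b_def d_def e_def c3_def distrib_left)
qed

text \<open>
  Vanishing of the Evans function is the boundary condition \<open>u'(0) = v'(0) w(0) = -v0 (1 - v0) w(0)\<close>.
  Inserted in the energy inequality, with \<open>\<delta> = 1 - v0\<close>, it leaves
  \<open>0 \<le> -|w - \<delta> u|\<^sup>2 / 2 - (1 / (-ln v0) - \<delta>\<^sup>2 / 2) |u|\<^sup>2\<close> at \<open>x = 0\<close>. Above \<open>v_star\<close> the bracket is
  positive, so \<open>u\<close>, \<open>w\<close> and then the whole solution vanish at \<open>0\<close>.
\<close>

lemma D0_out_nonzero:
  assumes v0: "v_star < v0" "v0 < 1" and l: "Re l \<ge> 0" "l \<noteq> 0"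
    and V: "V l \<noteq> 0" "A0_minf v0 l *v V l = mu_minus v0 l *s V l"
  shows "D0_out v0 V l \<noteq> 0"
proof
  assume D: "D0_out v0 V l = 0"
  note v0p = v_star_bound[OF v0]
  define W where "W = W1_out v0 V l"
  define \<delta> where "\<delta> = 1 - v0"
  have \<delta>: "\<delta> > 0" using v0 by (simp add: \<delta>_def)
  note mu = mu_minus_char[OF v0p(1) v0(2) l(1)]
  note char = W1_out_char[where V = V, OF v0p(1) v0(2) l V(2), folded W_def]
  have dv: "deriv (vhat v0) 0 = - (v0 * \<delta>)"
  proof -
    have "vhat v0 = (\<lambda>x. logistic ((1 - v0) / v0) (- x))" using vhat_eq v0p v0 by blast
    then show ?thesis
      using DERIV_imp_deriv[OF vhat_ode_solution[OF v0p(1) v0(2), of 0]] logistic_at_0[OF v0p(1)]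
      by (simp add: \<delta>_def algebra_simps)
  qed
  define z where "z = l + of_real (v0 * \<delta>)"
  have z: "z \<noteq> 0"
  proof -
    have "Re z > 0" using l(1) mult_pos_pos[OF v0p(1) \<delta>] by (simp add: z_def)
    then show ?thesis by auto
  qed
  have "- W 0 $ 2 - W 0 $ 3 * (l / z) = 0"
    using D by (simp add: D0_out_def cdot_def sum_3 W_def dv z_def)
  then have "z * W 0 $ 2 + l * W 0 $ 3 = 0"
    using z by (simp add: field_simps) (metis add.left_inverse)
  then have "l * (W 0 $ 2 + W 0 $ 3) + of_real (v0 * \<delta>) * W 0 $ 2 = 0"
    by (simp add: z_def algebra_simps)
  then have bc: "l * (W 0 $ 2 + W 0 $ 3) = - of_real (v0 * \<delta>) * W 0 $ 2"
    by (simp add: eq_neg_iff_add_eq_0)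
  define a b where "a = W 0 $ 1" and "b = W 0 $ 2"
  have "0 \<le> Re (a * cnj (- of_real (v0 * \<delta>) * b)) / \<delta> + Re (b * cnj a) - (cmod b)\<^sup>2 / 2 + (cmod a)\<^sup>2 / ln v0"
    using outflow_energy[OF char(1) v0p(1) v0(2) char(2) Re_root_ge_1[OF mu(2) l(1) mu(1)] l(1)]
    unfolding bc a_def b_def \<delta>_def .
  also have "\<dots> = - (cmod (b - of_real \<delta> * a))\<^sup>2 / 2 - (- 1 / ln v0 - \<delta>\<^sup>2 / 2) * (cmod a)\<^sup>2"
  proof -
    have "Re (a * cnj (- of_real (v0 * \<delta>) * b)) / \<delta> = - v0 * Re (b * cnj a)"
      using \<delta> by (simp add: field_simps)
    moreover have "- v0 * Re (b * cnj a) + Re (b * cnj a) - (cmod b)\<^sup>2 / 2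
        = - (cmod (b - of_real \<delta> * a))\<^sup>2 / 2 + \<delta>\<^sup>2 / 2 * (cmod a)\<^sup>2"
      unfolding cmod_power2 \<delta>_def by (simp add: power2_eq_square field_simps)
    ultimately show ?thesis by (simp add: left_diff_distrib)
  qed
  finally have ineq: "(cmod (b - of_real \<delta> * a))\<^sup>2 / 2 + (- 1 / ln v0 - \<delta>\<^sup>2 / 2) * (cmod a)\<^sup>2 \<le> 0"
    by simp
  have gap: "- 1 / ln v0 - \<delta>\<^sup>2 / 2 > 0"
  proof -
    have "- ln v0 > 0" using v0 v0p by simp
    then show ?thesis using v0p(2) \<delta> by (simp add: \<delta>_def[symmetric] field_simps)
  qed
  have a0: "a = 0"
  proof (rule ccontr)
    assume "a \<noteq> 0"
    then have "(- 1 / ln v0 - \<delta>\<^sup>2 / 2) * (cmod a)\<^sup>2 > 0" using gap by simp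
    then show False using ineq zero_le_power2[of "cmod (b - of_real \<delta> * a)"] by linarith
  qed
  then have b0: "b = 0" using ineq by simp
  then have "W 0 $ 3 = 0" using bc l by (simp add: b_def)
  then have "exp (- mu_minus v0 l * of_real 0) *s W 0 = 0"
    using a0 b0 by (simp add: a_def b_def vec3_eq_iff)
  from logistic_solution_zero[OF char(2) _ this] show False
    using v0 v0p V(1) by simp
qed

theorem proposition3p6:
  "(\<forall>v0::real. 0 < v0 \<and> v0 < 1 \<longrightarrow>
      (\<forall>l::complex. l \<noteq> 0 \<and> 0 \<le> Re l \<longrightarrow> D0_in v0 l \<noteq> 0)) \<and>
   (\<forall>v0::real. v_star < v0 \<and> v0 < 1 \<longrightarrow>
      (\<forall>V. analytic_eigenvector v0 V \<longrightarrow>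
        (\<forall>l::complex. l \<noteq> 0 \<and> 0 \<le> Re l \<longrightarrow> D0_out v0 V l \<noteq> 0)))"
  using D0_in_nonzero D0_out_nonzero unfolding analytic_eigenvector_def by blast

end
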